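(* Let $p,q:\mathbb{R}\to\mathbb{C}$ be $1$-periodic functions, not depending on $h$, with $p,q\in AC_{\rm loc}(\mathbb{R})$ and $p',q'\in L^\infty(\mathbb{R})$. Moreover, assume $\overline{p}\,\overline{q}=pq$. For $h>0$ let $\sigma(\mathfrak{D})\subset\mathbb{C}$ be the $L^2(\mathbb{R})^2$-spectrum of the Dirac operator $\mathfrak{D}$ with potentials $p,q$ and semiclassical parameter $h$. Define $$\Sigma(p,q):=\mathbb{R}\cup i\left[-(\|p\|_\infty\|q\|_\infty)^{1/2},(\|p\|_\infty\|q\|_\infty)^{1/2}\right]\subset\mathbb{C},$$ and for $\delta>0$ let $N_\delta(\Sigma)$ be the $\delta$-neighborhood of $\Sigma(p,q)$ in $\mathbb{C}$. Then for any $\delta>0$ there exists $h_o>0$ such that $$\sigma(\mathfrak{D})\subset N_\delta(\Sigma)\quad\text{for all } 0<h<h_o.$$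
   Context: The Dirac operator is the differential expression $\mathfrak{D}:= ih\sigma_3\partial_x + Q(x)$, $x\in\mathbb{R}$, where $i$ is the imaginary unit, $h>0$ is the semiclassical parameter, $\sigma_3=\begin{pmatrix}1&0\\0&-1\end{pmatrix}$ and $Q(x)=\begin{pmatrix}0&-iq(x)\\ ip(x)&0\end{pmatrix}$. It is realized as the densely and maximally defined closed operator $H\Psi=\mathfrak{D}\Psi$ in $L^2(\mathbb{R})^2=L^2(\mathbb{R};\mathbb{C}^2)$ with domain $\{\Psi\in L^2(\mathbb{R})^2:\Psi\in AC_{\rm loc}(\mathbb{R})^2,\ \mathfrak{D}\Psi\in L^2(\mathbb{R})^2\}$, where $AC_{\rm loc}(\mathbb{R})$ denotes the locally absolutely continuous complex-valued functions. $\sigma(\mathfrak{D})$ denotes the spectrum of this operator (it depends on $h$). $\|\cdot\|_\infty$ is the $L^\infty(\mathbb{R})$ (essential supremum) norm, and overbar denotes complex conjugation. The $\delta$-neighborhood of a set is the set of points of $\mathbb{C}$ at Euclidean distance less than $\delta$ from it. *)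

theory Defs
  imports "HOL-Analysis.Analysis" "HOL-Probability.Essential_Supremum"
begin

text \<open>
  Locally absolutely continuous functions, by the usual epsilon-delta condition on every compact
  interval. A finite set \<open>d\<close> with \<open>d division_of \<Union>d\<close> is a finite family of nonempty compact
  intervals \<open>k = {Inf k..Sup k}\<close> with pairwise disjoint interiors.
\<close>

definition AC_loc :: "(real \<Rightarrow> complex) set" where
  "AC_loc = {f. \<forall>a b. \<forall>\<epsilon>>0. \<exists>\<delta>>0. \<forall>d.
     d division_of \<Union>d \<and> \<Union>d \<subseteq> {a..b} \<and> (\<Sum>k\<in>d. Sup k - Inf k) < \<delta>
       \<longrightarrow> (\<Sum>k\<in>d. norm (f (Sup k) - f (Inf k))) < \<epsilon>}"

definition Linf_norm_ereal :: "(real \<Rightarrow> complex) \<Rightarrow> ereal" where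
  "Linf_norm_ereal f = esssup lebesgue (\<lambda>x. ereal (norm (f x)))"

definition Linf :: "(real \<Rightarrow> complex) set" where
  "Linf = {f \<in> borel_measurable lebesgue. Linf_norm_ereal f < \<infinity>}"

definition Linf_norm :: "(real \<Rightarrow> complex) \<Rightarrow> real" where
  "Linf_norm f = real_of_ereal (Linf_norm_ereal f)"

text \<open>
  Elements of \<open>L\<^sup>2(\<real>; \<complex>\<^sup>2)\<close> are handled through their representatives; equality in
  \<open>L\<^sup>2\<close> is equality almost everywhere. The norm on \<^typ>\<open>complex^2\<close> is the Euclidean one.
\<close>

definition L2 :: "(real \<Rightarrow> complex^2) set" where
  "L2 = {\<Psi> \<in> borel_measurable lebesgue. integrable lebesgue (\<lambda>x. (norm (\<Psi> x))\<^sup>2)}"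

definition L2_norm :: "(real \<Rightarrow> complex^2) \<Rightarrow> real" where
  "L2_norm \<Psi> = sqrt (\<integral>x. (norm (\<Psi> x))\<^sup>2 \<partial>lebesgue)"

text \<open>
  Resolvent set and spectrum of an unbounded operator \<open>T\<close> in \<open>L\<^sup>2(\<real>; \<complex>\<^sup>2)\<close> with domain
  \<open>D\<close>: \<open>z\<close> is in the resolvent set iff \<open>T - z\<close> is injective on \<open>D\<close>, maps \<open>D\<close> onto \<open>L\<^sup>2\<close>, and
  has a bounded inverse.
\<close>

definition resolvent_set ::
    "(real \<Rightarrow> complex^2) set \<Rightarrow> ((real \<Rightarrow> complex^2) \<Rightarrow> real \<Rightarrow> complex^2) \<Rightarrow> complex set" where
  "resolvent_set D T = {z.
     (\<forall>\<Psi>\<in>D. \<forall>\<Phi>\<in>D. (AE x in lebesgue. T \<Psi> x - z *s \<Psi> x = T \<Phi> x - z *s \<Phi> x)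
        \<longrightarrow> (AE x in lebesgue. \<Psi> x = \<Phi> x)) \<and>
     (\<forall>f\<in>L2. \<exists>\<Psi>\<in>D. AE x in lebesgue. T \<Psi> x - z *s \<Psi> x = f x) \<and>
     (\<exists>C. \<forall>\<Psi>\<in>D. L2_norm \<Psi> \<le> C * L2_norm (\<lambda>x. T \<Psi> x - z *s \<Psi> x))}"

definition spectrum ::
    "(real \<Rightarrow> complex^2) set \<Rightarrow> ((real \<Rightarrow> complex^2) \<Rightarrow> real \<Rightarrow> complex^2) \<Rightarrow> complex set" where
  "spectrum D T = - resolvent_set D T"

definition \<sigma>\<^sub>3 :: "complex^2^2" where
  "\<sigma>\<^sub>3 = vector [vector [1, 0], vector [0, -1]]"

definition Q_matrix :: "(real \<Rightarrow> complex) \<Rightarrow> (real \<Rightarrow> complex) \<Rightarrow> real \<Rightarrow> complex^2^2" where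
  "Q_matrix p q x = vector [vector [0, - \<i> * q x], vector [\<i> * p x, 0]]"

definition dirac ::
    "real \<Rightarrow> (real \<Rightarrow> complex) \<Rightarrow> (real \<Rightarrow> complex) \<Rightarrow> (real \<Rightarrow> complex^2) \<Rightarrow> real \<Rightarrow> complex^2" where
  "dirac h p q \<Psi> x =
     (\<i> * of_real h) *s (\<sigma>\<^sub>3 *v vector_derivative \<Psi> (at x)) + Q_matrix p q x *v \<Psi> x"

text \<open>
  The maximal domain. Locally absolutely continuous functions are differentiable almost
  everywhere, so the differentiability clause is redundant; it is written out because
  \<^const>\<open>vector_derivative\<close> has an arbitrary value wherever the derivative does not exist.
\<close>

definition dirac_domain ::
    "real \<Rightarrow> (real \<Rightarrow> complex) \<Rightarrow> (real \<Rightarrow> complex) \<Rightarrow> (real \<Rightarrow> complex^2) set" where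
  "dirac_domain h p q = {\<Psi> \<in> L2.
     (\<forall>j. (\<lambda>x. \<Psi> x $ j) \<in> AC_loc) \<and>
     (AE x in lebesgue. \<Psi> differentiable (at x)) \<and>
     dirac h p q \<Psi> \<in> L2}"

definition dirac_spectrum ::
    "real \<Rightarrow> (real \<Rightarrow> complex) \<Rightarrow> (real \<Rightarrow> complex) \<Rightarrow> complex set" where
  "dirac_spectrum h p q = spectrum (dirac_domain h p q) (dirac h p q)"

definition Sigma_set :: "(real \<Rightarrow> complex) \<Rightarrow> (real \<Rightarrow> complex) \<Rightarrow> complex set" where
  "Sigma_set p q = \<real> \<union>
     (\<lambda>t. \<i> * complex_of_real t) `
       {- sqrt (Linf_norm p * Linf_norm q) .. sqrt (Linf_norm p * Linf_norm q)}"

definition neighborhood :: "real \<Rightarrow> complex set \<Rightarrow> complex set" where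
  "neighborhood \<delta> S = (\<Union>w\<in>S. ball w \<delta>)"

end

theory Submission
  imports Defs
begin

text \<open>
  The equation \<open>(\<DD> - z) \<Psi> = f\<close> is a linear system \<open>h v' = A(x) v + g\<close> with
  \<open>A = ((-\<zeta>, q), (p, \<zeta>))\<close>, \<open>\<zeta> = i z\<close> and \<open>|g| = |f|\<close> pointwise. The eigenvalues of \<open>A(x)\<close> are
  \<open>\<plusminus>\<lambda>(x)\<close> with \<open>\<lambda>\<^sup>2 = pq - z\<^sup>2\<close>. The hypothesis on \<open>p\<close> and \<open>q\<close> says that \<open>pq\<close> is real, so \<open>pq\<close> takes
  values in \<open>[-m, m]\<close> with \<open>m = \<parallel>p\<parallel> \<parallel>q\<parallel>\<close>, and \<open>\<lambda>\<close> can be imaginary only if \<open>z\<^sup>2\<close> lies in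
  \<open>[-m, \<infinity>)\<close>, that is, if \<open>z\<close> lies in \<open>\<Sigma>(p, q)\<close>. Quantitatively, \<open>Re \<lambda>\<close> is bounded below by a
  constant \<open>c > 0\<close> for all \<open>z\<close> at distance at least \<open>\<delta>\<close> from \<open>\<Sigma>(p, q)\<close>, uniformly in \<open>x\<close> and \<open>z\<close>
  (\<open>Re_sqrt_lower_bound\<close>). As \<open>A\<close> varies slowly on the scale \<open>h\<close>, such a \<open>z\<close> should be in
  the resolvent set for small \<open>h\<close>.

  To prove this, take first \<open>Im z < 0\<close>. Then \<open>\<mu> = \<lambda> + \<zeta>\<close> satisfies \<open>Re \<mu> \<ge> \<delta>\<close>; with
  \<open>a = q/\<mu>\<close> and \<open>b = p/\<mu>\<close> the new unknowns \<open>u = v\<^sub>2 + b v\<^sub>1\<close> and \<open>w = v\<^sub>1 - a v\<^sub>2\<close> diagonalize \<open>A\<close>: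
  \<open>h u' = \<lambda> u + h b' v\<^sub>1 + (g\<^sub>2 + b g\<^sub>1)\<close> and \<open>h w' = - \<lambda> w - h a' v\<^sub>2 + (g\<^sub>1 - a g\<^sub>2)\<close>.
  The zeros of \<open>p\<close> and \<open>q\<close> do no harm, since the determinant \<open>1 + ab = 2\<lambda>/\<mu>\<close> of the
  transformation stays away from \<open>0\<close>. The coupling terms carry a factor \<open>h\<close>, and \<open>a'\<close> and \<open>b'\<close>
  are bounded uniformly in \<open>z\<close>. The case \<open>Im z > 0\<close> is reduced to this one by exchanging the
  two components, which exchanges \<open>p\<close> and \<open>q\<close> and changes the sign of \<open>z\<close> (\<open>well_posed_swap\<close>).

  The function \<open>E = |u|\<^sup>2 - |w|\<^sup>2\<close> is then a Lyapunov function: \<open>h E' \<ge> \<alpha> |v|\<^sup>2 - \<beta> |g|\<^sup>2\<close> for small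
  \<open>h\<close>. Integration over long intervals, at whose ends \<open>E\<close> is small, gives the estimate
  \<open>\<alpha> \<integral>|v|\<^sup>2 \<le> \<beta> \<integral>|g|\<^sup>2\<close>, hence injectivity and the bound for the inverse (\<open>a_priori_bound\<close>).
  For surjectivity, each scalar equation has a bounded solution given by an explicit Green
  function that integrates from \<open>+\<infinity>\<close> or from \<open>-\<infinity>\<close>; the coupling is a contraction on
  bounded continuous functions, so the coupled system has a bounded solution, and since \<open>E\<close> is
  bounded along it, the energy inequality shows that it is square integrable
  (\<open>solution_exists\<close>).

  The coefficients and the right-hand sides are merely measurable, so the argument rests on two
  facts about locally absolutely continuous functions: they are the integrals of their
  derivatives (\<open>AC_loc_has_integral\<close>), and an indefinite integral is absolutely continuous
  and almost everywhere differentiable with the expected derivative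
  (\<open>indefinite_integral_AC_loc\<close>, \<open>indefinite_integral_has_derivative_AE\<close>).
\<close>

section \<open>Locally absolutely continuous functions\<close>

lemma division_of_real_interval:
  fixes d :: "real set set"
  assumes "d division_of S" "k \<in> d"
  shows "k = {Inf k..Sup k}" "Inf k \<le> Sup k" "Inf k \<in> k" "Sup k \<in> k"
proof -
  obtain u v where k: "k = cbox u v" and "k \<noteq> {}"
    using division_ofD(3,4)[OF assms] by blast
  then have "u \<le> v" by auto
  with k show "k = {Inf k..Sup k}" "Inf k \<le> Sup k" "Inf k \<in> k" "Sup k \<in> k" by auto
qed

lemma division_total_length:
  fixes d :: "real set set"
  assumes "d division_of \<Union>d"
  shows "(\<Sum>k\<in>d. Sup k - Inf k) = measure lebesgue (\<Union>d)"
proof -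
  have "(\<Sum>k\<in>d. Sup k - Inf k) = sum (measure lebesgue) d"
  proof (rule sum.cong)
    fix k assume "k \<in> d"
    then have k: "k = {Inf k..Sup k}" "Inf k \<le> Sup k"
      using division_of_real_interval[OF assms] by blast+
    show "Sup k - Inf k = measure lebesgue k" using k(2) by (subst k(1)) simp
  qed simp
  then show ?thesis using content_division[OF assms] by simp
qed

lemma AC_locD:
  assumes "f \<in> AC_loc" "\<epsilon> > 0"
  obtains \<delta> where "\<delta> > 0" "\<forall>d. d division_of \<Union>d \<and> \<Union>d \<subseteq> {a..b} \<and> (\<Sum>k\<in>d. Sup k - Inf k) < \<delta>
     \<longrightarrow> (\<Sum>k\<in>d. norm (f (Sup k) - f (Inf k))) < \<epsilon>"
proof -
  have "\<exists>\<delta>>0. \<forall>d. d division_of \<Union>d \<and> \<Union>d \<subseteq> {a..b} \<and> (\<Sum>k\<in>d. Sup k - Inf k) < \<delta>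
       \<longrightarrow> (\<Sum>k\<in>d. norm (f (Sup k) - f (Inf k))) < \<epsilon>"
    using assms(1)[unfolded AC_loc_def mem_Collect_eq, rule_format, OF assms(2)] by simp
  then show ?thesis by (elim exE conjE) (rule that)
qed

text \<open>
  All closure properties below come from this comparison of increments; two dominating functions
  are allowed in order to cover sums and products.
\<close>

lemma AC_loc_dominated2:
  assumes f: "f \<in> AC_loc" and g: "g \<in> AC_loc"
    and C: "\<And>a b. \<exists>C. \<forall>x\<in>{a..b}. \<forall>y\<in>{a..b}.
      norm (k x - k y) \<le> C * (norm (f x - f y) + norm (g x - g y))"
  shows "k \<in> AC_loc"
  unfolding AC_loc_def
proof (rule CollectI, intro allI impI)
  fix a b \<epsilon> :: real assume "\<epsilon> > 0"
  obtain C0 where C0: "\<forall>x\<in>{a..b}. \<forall>y\<in>{a..b}.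
      norm (k x - k y) \<le> C0 * (norm (f x - f y) + norm (g x - g y))" using C by blast
  define C where "C = \<bar>C0\<bar> + 1"
  have "C > 0" by (simp add: C_def)
  have C: "norm (k x - k y) \<le> C * (norm (f x - f y) + norm (g x - g y))"
    if "x \<in> {a..b}" "y \<in> {a..b}" for x y
  proof -
    have "C0 * (norm (f x - f y) + norm (g x - g y)) \<le> C * (norm (f x - f y) + norm (g x - g y))"
      unfolding C_def by (intro mult_right_mono) auto
    then show ?thesis using C0 that by force
  qed
  have e: "\<epsilon> / (2 * C) > 0" using \<open>\<epsilon> > 0\<close> \<open>C > 0\<close> by simp
  obtain \<delta>1 where d1: "\<delta>1 > 0" "\<forall>d. d division_of \<Union>d \<and> \<Union>d \<subseteq> {a..b} \<and> (\<Sum>k\<in>d. Sup k - Inf k) < \<delta>1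
     \<longrightarrow> (\<Sum>k\<in>d. norm (f (Sup k) - f (Inf k))) < \<epsilon> / (2 * C)"
    by (rule AC_locD[OF f e, of a b])
  obtain \<delta>2 where d2: "\<delta>2 > 0" "\<forall>d. d division_of \<Union>d \<and> \<Union>d \<subseteq> {a..b} \<and> (\<Sum>k\<in>d. Sup k - Inf k) < \<delta>2
     \<longrightarrow> (\<Sum>k\<in>d. norm (g (Sup k) - g (Inf k))) < \<epsilon> / (2 * C)"
    by (rule AC_locD[OF g e, of a b])
  show "\<exists>\<delta>>0. \<forall>d. d division_of \<Union>d \<and> \<Union>d \<subseteq> {a..b} \<and> (\<Sum>k\<in>d. Sup k - Inf k) < \<delta> \<longrightarrow>
           (\<Sum>j\<in>d. norm (k (Sup j) - k (Inf j))) < \<epsilon>"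
  proof (intro exI[of _ "min \<delta>1 \<delta>2"] conjI allI impI)
    show "min \<delta>1 \<delta>2 > 0" using d1 d2 by simp
    fix d :: "real set set"
    assume d: "d division_of \<Union>d \<and> \<Union>d \<subseteq> {a..b} \<and> (\<Sum>k\<in>d. Sup k - Inf k) < min \<delta>1 \<delta>2"
    have "(\<Sum>j\<in>d. norm (k (Sup j) - k (Inf j)))
      \<le> (\<Sum>j\<in>d. C * (norm (f (Sup j) - f (Inf j)) + norm (g (Sup j) - g (Inf j))))"
    proof (rule sum_mono)
      fix j assume "j \<in> d"
      then have "Inf j \<in> {a..b}" "Sup j \<in> {a..b}"
        using division_of_real_interval(3,4)[of d "\<Union>d" j] d by blast+
      then show "norm (k (Sup j) - k (Inf j)) \<le> C * (norm (f (Sup j) - f (Inf j)) + norm (g (Sup j) - g (Inf j)))"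
        by (intro C)
    qed
    also have "\<dots> = C * ((\<Sum>j\<in>d. norm (f (Sup j) - f (Inf j))) + (\<Sum>j\<in>d. norm (g (Sup j) - g (Inf j))))"
      by (simp add: sum_distrib_left sum.distrib distrib_left)
    also have "\<dots> < C * (\<epsilon> / (2 * C) + \<epsilon> / (2 * C))"
      using d d1 d2 \<open>C > 0\<close> by (intro mult_strict_left_mono add_strict_mono) auto
    also have "\<dots> = \<epsilon>" using \<open>C > 0\<close> by (simp add: field_simps)
    finally show "(\<Sum>j\<in>d. norm (k (Sup j) - k (Inf j))) < \<epsilon>" .
  qed
qed

lemma AC_loc_dominated:
  assumes "f \<in> AC_loc" "\<And>x y. norm (k x - k y) \<le> C * norm (f x - f y)"
  shows "k \<in> AC_loc"
proof (rule AC_loc_dominated2[OF assms(1) assms(1)], intro exI[of _ "C/2"] ballI)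
  show "norm (k x - k y) \<le> C / 2 * (norm (f x - f y) + norm (f x - f y))" for x y
    using assms(2)[of x y] by (simp add: field_simps)
qed

lemma AC_loc_continuous:
  assumes f: "f \<in> AC_loc"
  shows "continuous_on A f"
proof -
  have "\<exists>d>0. \<forall>y. dist y x < d \<longrightarrow> dist (f y) (f x) < e" if "e > 0" for x e :: real
  proof -
    obtain \<delta> where \<delta>: "\<delta> > 0"
      and *: "\<forall>d. d division_of \<Union>d \<and> \<Union>d \<subseteq> {x-1..x+1} \<and> (\<Sum>k\<in>d. Sup k - Inf k) < \<delta>
        \<longrightarrow> (\<Sum>k\<in>d. norm (f (Sup k) - f (Inf k))) < e"
      by (rule AC_locD[OF f \<open>e > 0\<close>, of "x-1" "x+1"])
    have **: "norm (f v - f u) < e" if "u \<le> v" "x - 1 \<le> u" "v \<le> x + 1" "v - u < \<delta>" for u v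
    proof -
      have "{{u..v}} division_of {u..v}"
        using division_of_self[of u v] that by (simp add: box_real)
      with *[rule_format, of "{{u..v}}"] that show ?thesis by simp
    qed
    show ?thesis
    proof (intro exI[of _ "min 1 \<delta>"] conjI allI impI)
      fix y assume "dist y x < min 1 \<delta>"
      then show "dist (f y) (f x) < e"
        using **[of x y] **[of y x] by (cases "x \<le> y") (auto simp: dist_norm norm_minus_commute abs_if split: if_splits)
    qed (use \<delta> in simp)
  qed
  then have "continuous_on UNIV f" unfolding continuous_on_iff by auto
  then show ?thesis by (rule continuous_on_subset) simp
qed

lemma AC_loc_add:
  assumes "f \<in> AC_loc" "g \<in> AC_loc" shows "(\<lambda>x. f x + g x) \<in> AC_loc"
proof (rule AC_loc_dominated2[OF assms], intro exI[of _ 1] ballI)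
  show "norm (f x + g x - (f y + g y)) \<le> 1 * (norm (f x - f y) + norm (g x - g y))" for x y
    using norm_triangle_ineq[of "f x - f y" "g x - g y"] by (simp add: algebra_simps)
qed

lemma AC_loc_mult:
  assumes f: "f \<in> AC_loc" and g: "g \<in> AC_loc" shows "(\<lambda>x. f x * g x) \<in> AC_loc"
proof (rule AC_loc_dominated2[OF assms])
  fix a b :: real
  have "compact (f ` {a..b})" "compact (g ` {a..b})"
    by (intro compact_continuous_image AC_loc_continuous f g; simp)+
  then obtain B1 B2 where B1: "\<And>x. x \<in> {a..b} \<Longrightarrow> norm (f x) \<le> B1"
      and B2: "\<And>x. x \<in> {a..b} \<Longrightarrow> norm (g x) \<le> B2"
    by (metis bounded_iff compact_imp_bounded imageI)
  define B where "B = max B1 B2"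
  have B: "norm (f x) \<le> B \<and> norm (g x) \<le> B" if "x \<in> {a..b}" for x
    using B1[OF that] B2[OF that] by (auto simp: B_def)
  show "\<exists>C. \<forall>x\<in>{a..b}. \<forall>y\<in>{a..b}. norm (f x * g x - f y * g y) \<le> C * (norm (f x - f y) + norm (g x - g y))"
  proof (intro exI[of _ B] ballI)
    fix x y assume xy: "x \<in> {a..b}" "y \<in> {a..b}"
    have "norm (f x * g x - f y * g y) = norm ((f x - f y) * g x + f y * (g x - g y))"
      by (simp add: algebra_simps)
    also have "\<dots> \<le> norm (f x - f y) * norm (g x) + norm (f y) * norm (g x - g y)"
      by (metis norm_mult norm_triangle_ineq)
    also have "\<dots> \<le> norm (f x - f y) * B + B * norm (g x - g y)"
      using B xy order_trans[OF norm_ge_zero conjunct1[OF B[OF xy(1)]]] by (intro add_mono mult_mono) auto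
    finally show "norm (f x * g x - f y * g y) \<le> B * (norm (f x - f y) + norm (g x - g y))"
      by (simp add: algebra_simps)
  qed
qed

lemma AC_loc_cnj: "f \<in> AC_loc \<Longrightarrow> (\<lambda>x. cnj (f x)) \<in> AC_loc"
  by (rule AC_loc_dominated[of f _ 1]) (auto simp flip: complex_cnj_diff)

lemma AC_loc_minus: "f \<in> AC_loc \<Longrightarrow> (\<lambda>x. - f x) \<in> AC_loc"
  by (rule AC_loc_dominated[of f _ 1]) (auto simp: norm_minus_commute)

lemma AC_loc_diff: "f \<in> AC_loc \<Longrightarrow> g \<in> AC_loc \<Longrightarrow> (\<lambda>x. f x - g x) \<in> AC_loc"
  using AC_loc_add[OF _ AC_loc_minus] by simp

text \<open>
  The fundamental theorem of calculus, by Riemann sums of the gauge integral. Let \<open>N\<close> be the null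
  set where the derivative fails to exist. Outside \<open>N\<close> the gauge makes the difference quotients
  close to the derivative. A point of \<open>N\<close> gets as gauge an open set \<open>U \<supseteq> N\<close> of small measure;
  the intervals tagged by \<open>N\<close> then have small total length, so absolute continuity bounds the
  increments of \<open>f\<close> over them, while the integrand can be set to \<open>0\<close> there.
\<close>

theorem AC_loc_has_integral:
  assumes f: "f \<in> AC_loc" and der: "AE x in lebesgue. (f has_vector_derivative f' x) (at x)"
    and "a \<le> b"
  shows "(f' has_integral f b - f a) {a..b}"
proof -
  obtain N where N: "N \<in> null_sets lebesgue" and dN: "\<And>x. x \<notin> N \<Longrightarrow> (f has_vector_derivative f' x) (at x)"
    using der unfolding completion.AE_iff_null_sets by auto
  define g where "g = (\<lambda>x. if x \<in> N then 0 else f' x)"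
  have "(g has_integral f b - f a) (cbox a b)"
    unfolding has_integral
  proof (intro allI impI)
    fix e :: real assume "e > 0"
    define e1 where "e1 = e / (2 * (b - a + 1))"
    have e1: "e1 > 0" "e1 * (b - a) < e / 2"
      using \<open>e > 0\<close> \<open>a \<le> b\<close> by (auto simp: e1_def field_simps)
    obtain \<delta> where \<delta>: "\<delta> > 0"
      and AC: "\<forall>d. d division_of \<Union>d \<and> \<Union>d \<subseteq> {a..b} \<and> (\<Sum>k\<in>d. Sup k - Inf k) < \<delta>
     \<longrightarrow> (\<Sum>k\<in>d. norm (f (Sup k) - f (Inf k))) < e / 2"
      by (rule AC_locD[OF f half_gt_zero[OF \<open>e > 0\<close>], of a b])
    obtain U where U: "open U" "N \<subseteq> U" "U - N \<in> lmeasurable" "emeasure lebesgue (U - N) < ennreal \<delta>"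
      using sets_lebesgue_outer_open[of N \<delta>] N \<delta> by (auto dest: null_setsD2)
    have Um: "U \<in> lmeasurable" "measure lebesgue U < \<delta>"
    proof -
      have UU: "U = (U - N) \<union> N" using U by auto
      show "U \<in> lmeasurable"
        using U(3) N by (subst UU) (intro fmeasurable.Un, auto simp: negligible_iff_null_sets[symmetric] negligible_imp_measurable)
      have "measure lebesgue U = measure lebesgue (U - N)"
        using U(3) N by (metis UU fmeasurableD measure_Un_null_set)
      also have "\<dots> < \<delta>"
        using U(3,4) \<delta> by (metis emeasure_eq_measure2 ennreal_less_iff measure_nonneg)
      finally show "measure lebesgue U < \<delta>" .
    qed
    have "\<exists>r>0. \<forall>y. norm (y - x) < r \<longrightarrow> norm (f y - f x - (y - x) *\<^sub>R f' x) \<le> e1 * norm (y - x)"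
      if "x \<notin> N" for x
      using dN[OF that] e1(1) unfolding has_vector_derivative_def has_derivative_at_alt by blast
    then obtain r where r: "\<And>x. x \<notin> N \<Longrightarrow> r x > 0"
      and r': "\<And>x y. x \<notin> N \<Longrightarrow> norm (y - x) < r x \<Longrightarrow> norm (f y - f x - (y - x) *\<^sub>R f' x) \<le> e1 * norm (y - x)"
      by metis
    define \<gamma> where "\<gamma> = (\<lambda>x. if x \<in> N then U else ball x (r x))"
    have "gauge \<gamma>" unfolding gauge_def \<gamma>_def using U r by auto
    show "\<exists>\<gamma>. gauge \<gamma> \<and> (\<forall>D. D tagged_division_of cbox a b \<and> \<gamma> fine D \<longrightarrow>
         norm ((\<Sum>(x, k)\<in>D. measure lborel k *\<^sub>R g x) - (f b - f a)) < e)"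
    proof (intro exI[of _ \<gamma>] conjI allI impI, fact)
      fix D assume D: "D tagged_division_of cbox a b \<and> \<gamma> fine D"
      then have Dt: "D tagged_division_of cbox a b" and fine: "\<gamma> fine D" by auto
      have finD: "finite D" using Dt by blast
      define err where "err = (\<lambda>(x, k). norm (measure lborel k *\<^sub>R g x - (f (Sup k) - f (Inf k))))"
      define D1 where "D1 = {xk \<in> D. fst xk \<in> N}"
      define D2 where "D2 = D - D1"
      have Dsub: "D1 \<subseteq> D" "D2 \<subseteq> D" by (auto simp: D1_def D2_def)
      have "(\<Sum>(x, k)\<in>D. measure lborel k *\<^sub>R g x) - (f b - f a)
          = (\<Sum>(x, k)\<in>D. measure lborel k *\<^sub>R g x - (f (Sup k) - f (Inf k)))"
        using additive_tagged_division_1[of a b D f] \<open>a \<le> b\<close> Dt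
        by (simp add: sum_subtractf case_prod_beta box_real)
      then have "norm ((\<Sum>(x, k)\<in>D. measure lborel k *\<^sub>R g x) - (f b - f a)) \<le> sum err D"
        unfolding err_def by (simp add: case_prod_beta norm_sum)
      also have "\<dots> = sum err D1 + sum err D2"
        using finD Dsub by (simp add: D2_def sum.subset_diff add.commute)
      also have "sum err D2 \<le> e1 * (b - a)"
      proof -
        have "sum err D2 \<le> (\<Sum>(x, k)\<in>D2. e1 * measure lborel k)"
        proof (rule sum_mono, clarify)
          fix x k assume xk: "(x, k) \<in> D2"
          then have xkD: "(x, k) \<in> D" and xN: "x \<notin> N" by (auto simp: D1_def D2_def)
          obtain u v where k: "k = cbox u v" and "x \<in> k"
            using tagged_division_ofD(2,4)[OF Dt xkD] by auto
          then have uv: "u \<le> x" "x \<le> v" by auto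
          have "k \<subseteq> ball x (r x)" using fineD[OF fine xkD] xN by (simp add: \<gamma>_def)
          moreover have "u \<in> k" "v \<in> k" using uv k by auto
          ultimately have "u \<in> ball x (r x)" "v \<in> ball x (r x)" by blast+
          then have b: "norm (u - x) < r x" "norm (v - x) < r x"
            by (auto simp: dist_norm)
          have "err (x, k) = norm ((v - u) *\<^sub>R f' x - (f v - f u))"
            using uv xN by (simp add: err_def k g_def)
          also have "\<dots> = norm ((f u - f x - (u - x) *\<^sub>R f' x) - (f v - f x - (v - x) *\<^sub>R f' x))"
            by (simp add: algebra_simps)
          also have "\<dots> \<le> e1 * norm (u - x) + e1 * norm (v - x)"
            by (rule order_trans[OF norm_triangle_ineq4 add_mono[OF r'[OF xN b(1)] r'[OF xN b(2)]]])
          also have "\<dots> = e1 * measure lborel k" using uv k by (simp add: algebra_simps)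
          finally show "err (x, k) \<le> e1 * measure lborel k" .
        qed
        also have "\<dots> \<le> (\<Sum>(x, k)\<in>D. e1 * measure lborel k)"
          using finD Dsub e1(1) by (intro sum_mono2) (auto simp: )
        also have "\<dots> = e1 * (\<Sum>(x, k)\<in>D. measure lborel k)"
          by (simp add: sum_distrib_left case_prod_beta)
        also have "(\<Sum>(x, k)\<in>D. measure lborel k) = b - a"
          using additive_content_tagged_division[OF Dt] \<open>a \<le> b\<close> by simp
        finally show ?thesis .
      qed
      also have "sum err D1 < e / 2"
      proof -
        have tp: "D1 tagged_partial_division_of cbox a b"
          using Dt Dsub by (meson tagged_division_of_def tagged_partial_division_subset)
        have t1: "D1 tagged_division_of \<Union>(snd ` D1)"
          by (rule tagged_partial_division_of_Union_self[OF tp])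
        have div: "snd ` D1 division_of \<Union>(snd ` D1)"
          by (rule division_of_tagged_division[OF t1])
        have ne: "k \<noteq> {}" if "(x, k) \<in> D1" for x k
          using tagged_division_ofD(2)[OF t1 that] by auto
        \<comment> \<open>two tags may share a degenerate interval, so the sum over the tagged intervals can be
          rewritten as a sum over the intervals only for a function that vanishes on all degenerate
          ones, the empty interval included\<close>
        define \<Delta> where "\<Delta> = (\<lambda>k. if k = {} then 0 else norm (f (Sup k) - f (Inf k)))"
        have "sum err D1 = (\<Sum>(x, k)\<in>D1. \<Delta> k)"
          using ne by (intro sum.cong) (auto simp: err_def D1_def g_def norm_minus_commute \<Delta>_def)
        also have "\<dots> = (\<Sum>k\<in>snd ` D1. \<Delta> k)"
        proof (rule sum.over_tagged_division_lemma[OF t1])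
          fix u v :: real assume "box u v = {}"
          then have "v \<le> u" by simp
          then show "\<Delta> (cbox u v) = 0"
            by (cases "u = v") (auto simp: \<Delta>_def)
        qed
        also have "\<dots> = (\<Sum>k\<in>snd ` D1. norm (f (Sup k) - f (Inf k)))"
          using ne by (intro sum.cong) (auto simp: \<Delta>_def)
        also have "\<dots> < e / 2"
        proof (rule AC[rule_format], intro conjI)
          show "snd ` D1 division_of \<Union>(snd ` D1)" by (fact div)
          show "\<Union>(snd ` D1) \<subseteq> {a..b}"
            using tagged_division_ofD(3)[OF Dt] Dsub by fastforce
          have "\<Union>(snd ` D1) \<subseteq> U"
            using fine Dsub by (fastforce simp: fine_def D1_def \<gamma>_def)
          then have "measure lebesgue (\<Union>(snd ` D1)) \<le> measure lebesgue U"
            using lmeasurable_division[OF div] Um by (intro measure_mono_fmeasurable) auto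
          then show "(\<Sum>k\<in>snd ` D1. Sup k - Inf k) < \<delta>"
            using division_total_length[OF div] Um by simp
        qed
        finally show ?thesis .
      qed
      finally show "norm ((\<Sum>(x, k)\<in>D. measure lborel k *\<^sub>R g x) - (f b - f a)) < e"
        using e1(2) by simp
    qed
  qed
  then show ?thesis
    using N by (intro has_integral_spike[of N _ f' g]) (auto simp: negligible_iff_null_sets g_def)
qed


text \<open>
  Absolute continuity of the integral: the part of \<open>g\<close> above a large constant \<open>n\<close> has a small
  integral, and the rest contributes at most \<open>n\<close> times the measure of the set.
\<close>

lemma integral_small_on_small_sets:
  fixes g :: "real \<Rightarrow> real"
  assumes g: "integrable lebesgue g" and pos: "\<And>x. 0 \<le> g x" and e: "e > 0"
  obtains \<delta> where "\<delta> > 0"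
    "\<And>S. S \<in> lmeasurable \<Longrightarrow> measure lebesgue S < \<delta> \<Longrightarrow> (LINT x|lebesgue. indicator S x * g x) < e"
proof -
  have [measurable]: "g \<in> borel_measurable lebesgue" using g by simp
  have lim: "(\<lambda>n. LINT x|lebesgue. g x - min (g x) (real n)) \<longlonglongrightarrow> (LINT x::real|lebesgue. 0)"
  proof (rule integral_dominated_convergence[where w=g])
    show "AE x in lebesgue. (\<lambda>n. g x - min (g x) (real n)) \<longlonglongrightarrow> 0"
    proof (rule AE_I2)
      fix x
      have "\<forall>\<^sub>F n in sequentially. g x - min (g x) (real n) = 0"
        using eventually_ge_at_top[of "nat \<lceil>g x\<rceil>"] by eventually_elim (simp add: min_def; linarith)
      then show "(\<lambda>n. g x - min (g x) (real n)) \<longlonglongrightarrow> 0" by (rule tendsto_eventually)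
    qed
    show "AE x in lebesgue. norm (g x - min (g x) (real n)) \<le> g x" for n
      using pos by (intro AE_I2) (auto simp: min_def)
  qed (use g in auto)
  have "\<forall>\<^sub>F n in sequentially. (LINT x|lebesgue. g x - min (g x) (real n)) < e / 2"
    using order_tendstoD(2)[OF lim, of "e/2"] e by simp
  then obtain n where n: "(LINT x|lebesgue. g x - min (g x) (real n)) < e / 2"
    by (auto simp: eventually_sequentially)
  have intn: "integrable lebesgue (\<lambda>x. g x - min (g x) (real n))"
    using pos by (intro Bochner_Integration.integrable_bound[OF g]) (auto simp: min_def)
  show thesis
  proof (rule that[of "e / (2 * (real n + 1))"])
    show "e / (2 * (real n + 1)) > 0" using e by simp
    fix S :: "real set" assume S: "S \<in> lmeasurable" and mS: "measure lebesgue S < e / (2 * (real n + 1))"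
    have [measurable]: "S \<in> sets lebesgue" using S by auto
    have iS: "integrable lebesgue (\<lambda>x. real n * indicator S x)"
      using S by (intro integrable_mult_right integrable_real_indicator) (auto simp: fmeasurable_def)
    have "(LINT x|lebesgue. indicator S x * g x)
       \<le> (LINT x|lebesgue. real n * indicator S x + (g x - min (g x) (real n)))"
    proof (rule integral_mono)
      show "integrable lebesgue (\<lambda>x. indicator S x * g x)"
        using pos by (intro Bochner_Integration.integrable_bound[OF g]) (auto simp: indicator_def)
      show "integrable lebesgue (\<lambda>x. real n * indicator S x + (g x - min (g x) (real n)))"
        using iS intn by simp
    qed (auto simp: indicator_def)
    also have "\<dots> = real n * measure lebesgue S + (LINT x|lebesgue. g x - min (g x) (real n))"
      using iS intn S by (subst Bochner_Integration.integral_add) auto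
    also have "real n * measure lebesgue S \<le> (real n + 1) * measure lebesgue S"
      by (intro mult_right_mono) auto
    also have "\<dots> < e / 2" using mS by (simp add: field_simps)
    finally show "(LINT x|lebesgue. indicator S x * g x) < e" using n by simp
  qed
qed

lemma indefinite_integral_AC_loc:
  fixes f F :: "real \<Rightarrow> complex"
  assumes f: "\<And>a b. f absolutely_integrable_on {a..b}"
    and F: "\<And>a b. a \<le> b \<Longrightarrow> F b - F a = integral {a..b} f"
  shows "F \<in> AC_loc"
  unfolding AC_loc_def
proof (rule CollectI, intro allI impI)
  fix a b \<epsilon> :: real assume "\<epsilon> > 0"
  define g where "g = (\<lambda>x. indicator {a..b} x * norm (f x))"
  have "integrable lebesgue g"
    using set_integrable_norm[OF f[of a b]] by (simp add: g_def set_integrable_def)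
  then obtain \<delta> where \<delta>: "\<delta> > 0" and
    sm: "\<And>S. S \<in> lmeasurable \<Longrightarrow> measure lebesgue S < \<delta> \<Longrightarrow> (LINT x|lebesgue. indicator S x * g x) < \<epsilon>"
    using integral_small_on_small_sets[of g \<epsilon>] \<open>\<epsilon> > 0\<close> by (auto simp: g_def)
  show "\<exists>\<delta>>0. \<forall>d. d division_of \<Union>d \<and> \<Union>d \<subseteq> {a..b} \<and> (\<Sum>k\<in>d. Sup k - Inf k) < \<delta> \<longrightarrow>
           (\<Sum>k\<in>d. norm (F (Sup k) - F (Inf k))) < \<epsilon>"
  proof (intro exI[of _ \<delta>] conjI allI impI, fact)
    fix d :: "real set set"
    assume d: "d division_of \<Union>d \<and> \<Union>d \<subseteq> {a..b} \<and> (\<Sum>k\<in>d. Sup k - Inf k) < \<delta>"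
    have div: "d division_of \<Union>d" using d by blast
    have lm: "\<Union>d \<in> lmeasurable" by (rule lmeasurable_division[OF div])
    have fU: "f absolutely_integrable_on \<Union>d"
      using d lm by (intro set_integrable_subset[OF f[of a b]]) auto
    then have nU: "(\<lambda>x. norm (f x)) absolutely_integrable_on \<Union>d"
      by (rule set_integrable_norm)
    have "(\<Sum>k\<in>d. norm (F (Sup k) - F (Inf k))) \<le> (\<Sum>k\<in>d. integral k (\<lambda>x. norm (f x)))"
    proof (rule sum_mono)
      fix k assume "k \<in> d"
      then have k: "k = {Inf k..Sup k}" "Inf k \<le> Sup k"
        using division_of_real_interval[OF div] by blast+
      have "norm (F (Sup k) - F (Inf k)) = norm (integral {Inf k..Sup k} f)"
        using F[OF k(2)] by simp
      also have "\<dots> \<le> integral {Inf k..Sup k} (\<lambda>x. norm (f x))"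
        using f[of "Inf k" "Sup k"] set_integrable_norm[OF f[of "Inf k" "Sup k"]]
        by (intro integral_norm_bound_integral set_lebesgue_integral_eq_integral(1)) auto
      finally show "norm (F (Sup k) - F (Inf k)) \<le> integral k (\<lambda>x. norm (f x))"
        using k(1) by simp
    qed
    also have "\<dots> = integral (\<Union>d) (\<lambda>x. norm (f x))"
      using nU div by (intro integral_combine_division_topdown[symmetric] set_lebesgue_integral_eq_integral)
    also have "\<dots> = (LINT x|lebesgue. indicator (\<Union>d) x * norm (f x))"
      using set_lebesgue_integral_eq_integral(2)[OF nU] by (simp add: set_lebesgue_integral_def)
    also have "(\<lambda>x. indicator (\<Union>d) x * norm (f x)) = (\<lambda>x. indicator (\<Union>d) x * g x)"
      using d by (auto simp: g_def indicator_def fun_eq_iff)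
    also have "(LINT x|lebesgue. indicator (\<Union>d) x * g x) < \<epsilon>"
      using d division_total_length[OF div] by (intro sm lm) simp
    finally show "(\<Sum>k\<in>d. norm (F (Sup k) - F (Inf k))) < \<epsilon>" .
  qed
qed

text \<open>
  Lebesgue's differentiation theorem on the line. The proposition
  \<open>integrable_ccontinuous_explicit\<close> gives the limits of the quotients from the right; applied to
  the reflected function it gives those from the left.
\<close>

lemma indefinite_integral_has_derivative_AE:
  fixes f F :: "real \<Rightarrow> complex"
  assumes f: "\<And>a b. f integrable_on {a..b}"
    and F: "\<And>a b. a \<le> b \<Longrightarrow> F b - F a = integral {a..b} f"
  shows "AE x in lebesgue. (F has_vector_derivative f x) (at x)"
proof -
  have f': "(\<lambda>x. f (- x)) integrable_on {a..b}" for a b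
    using f[of "-b" "-a"] Henstock_Kurzweil_Integration.integrable_reflect_real[where f=f and a="-b" and b="-a"] by simp
  have right_quotient: "\<exists>N. negligible N \<and> (\<forall>x e. x \<notin> N \<and> 0 < e \<longrightarrow>
      (\<exists>d>0. \<forall>h. 0 < h \<and> h < d \<longrightarrow> norm (integral {x..x + h} g /\<^sub>R h - g x) < e))"
    if g: "\<And>a b. g integrable_on {a..b}" for g :: "real \<Rightarrow> complex"
  proof -
    have g': "g integrable_on cbox a b" for a b using g by simp
    show ?thesis
    proof (rule integrable_ccontinuous_explicit[of g, OF g'])
      fix N assume "negligible N" "\<And>x e. \<lbrakk>x \<notin> N; 0 < e\<rbrakk> \<Longrightarrow> \<exists>d>0. \<forall>h. 0 < h \<and> h < d \<longrightarrow>
         norm (integral (cbox x (x + h *\<^sub>R One)) g /\<^sub>R h ^ DIM(real) - g x) < e"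
      then show ?thesis by (intro exI[of _ N]) simp
    qed
  qed
  obtain N1 where N1: "negligible N1" and
    r: "\<And>x e. x \<notin> N1 \<Longrightarrow> 0 < e \<Longrightarrow>
      \<exists>d>0. \<forall>h. 0 < h \<and> h < d \<longrightarrow> norm (integral {x..x + h} f /\<^sub>R h - f x) < e"
    using right_quotient[OF f] by blast
  obtain N2 where N2: "negligible N2" and
    l: "\<And>x e. x \<notin> N2 \<Longrightarrow> 0 < e \<Longrightarrow>
      \<exists>d>0. \<forall>h. 0 < h \<and> h < d \<longrightarrow> norm (integral {x..x + h} (\<lambda>x. f (- x)) /\<^sub>R h - f (- x)) < e"
    using right_quotient[OF f'] by blast
  have N: "negligible (N1 \<union> uminus ` N2)"
    using N1 N2 by (intro negligible_Un negligible_differentiable_image_negligible) auto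
  have "(F has_vector_derivative f x) (at x)" if x: "x \<notin> N1 \<union> uminus ` N2" for x
    unfolding has_vector_derivative_def has_derivative_at_alt
  proof (intro conjI allI impI)
    show "bounded_linear (\<lambda>h. h *\<^sub>R f x)" by (rule bounded_linear_scaleR_left)
    fix e :: real assume e: "0 < e"
    have x1: "x \<notin> N1" and x2: "- x \<notin> N2" using x by (auto simp: image_iff) 
    obtain d1 where d1: "d1 > 0" "\<And>h. 0 < h \<Longrightarrow> h < d1 \<Longrightarrow> norm (integral {x..x + h} f /\<^sub>R h - f x) < e"
      using r[OF x1 e] by blast
    obtain d2 where d2: "d2 > 0"
      "\<And>h. 0 < h \<Longrightarrow> h < d2 \<Longrightarrow> norm (integral {-x..-x + h} (\<lambda>x. f (- x)) /\<^sub>R h - f x) < e"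
      using l[OF x2 e] by auto
    have scale: "norm (I - h *\<^sub>R f x) \<le> e * h" if "0 < h" "norm (I /\<^sub>R h - f x) < e" for I :: complex and h
    proof -
      have "I - h *\<^sub>R f x = h *\<^sub>R (I /\<^sub>R h - f x)" using that by (simp add: algebra_simps)
      then have "norm (I - h *\<^sub>R f x) = h * norm (I /\<^sub>R h - f x)" using that by simp
      also have "\<dots> \<le> h * e" using that by (intro mult_left_mono) auto
      finally show ?thesis by (simp add: mult.commute)
    qed
    show "\<exists>d>0. \<forall>y. norm (y - x) < d \<longrightarrow> norm (F y - F x - (y - x) *\<^sub>R f x) \<le> e * norm (y - x)"
    proof (intro exI[of _ "min d1 d2"] conjI allI impI)
      show "min d1 d2 > 0" using d1 d2 by simp
      fix y assume y: "norm (y - x) < min d1 d2"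
      consider "y = x" | "y > x" | "y < x" by linarith
      then show "norm (F y - F x - (y - x) *\<^sub>R f x) \<le> e * norm (y - x)"
      proof cases
        case 2
        have "F y - F x = integral {x..x + (y - x)} f" using F[of x y] 2 by simp
        then show ?thesis using scale[OF _ d1(2), of "y - x"] 2 y by simp
      next
        case 3
        have "F x - F y = integral {y..x} f" using F[of y x] 3 by simp
        also have "\<dots> = integral {-x..-y} (\<lambda>x. f (- x))"
          by (rule Henstock_Kurzweil_Integration.integral_reflect_real[symmetric])
        finally have *: "F x - F y = integral {-x..-x + (x - y)} (\<lambda>x. f (- x))" by simp
        have "norm (F y - F x - (y - x) *\<^sub>R f x) = norm ((F x - F y) - (x - y) *\<^sub>R f x)"
          by (simp add: norm_minus_commute algebra_simps)
        also have "\<dots> \<le> e * (x - y)"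
          unfolding * using 3 y by (intro scale d2(2)) auto
        finally show ?thesis using 3 by simp
      qed simp
    qed
  qed
  then show ?thesis
    using N by (intro AE_I'[of "N1 \<union> uminus ` N2"]) (auto simp: negligible_iff_null_sets)
qed

section \<open>Bounded solutions of scalar equations on the line\<close>

lemma continuous_primitive:
  fixes f :: "real \<Rightarrow> complex"
  assumes f: "continuous_on UNIV f"
  obtains \<Lambda> where "\<And>x. (\<Lambda> has_vector_derivative f x) (at x)"
proof
  fix x :: real
  define a b where "a = min 0 (x - 1)" and "b = max 0 (x + 1)"
  have "((\<lambda>u. LBINT y=(0::real)..u. f y) has_vector_derivative f x) (at x within {a..b})"
    using f by (intro interval_integral_FTC2) (auto simp: a_def b_def intro: continuous_on_subset)
  then show "((\<lambda>u. LBINT y=(0::real)..u. f y) has_vector_derivative f x) (at x)"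
    by (subst (asm) at_within_interior) (auto simp: a_def b_def)
qed

lemma AC_loc_continuous_derivative:
  fixes f :: "real \<Rightarrow> complex"
  assumes f: "\<And>x. (f has_vector_derivative f' x) (at x)" and f': "continuous_on UNIV f'"
  shows "f \<in> AC_loc"
proof (rule indefinite_integral_AC_loc)
  show "f' absolutely_integrable_on {a..b}" for a b
    using f' by (intro absolutely_integrable_continuous_real) (auto intro: continuous_on_subset)
  show "f b - f a = integral {a..b} f'" if "a \<le> b" for a b
    using that f by (intro integral_unique[symmetric] fundamental_theorem_of_calculus)
      (auto intro: has_vector_derivative_at_within)
qed

lemma tail_integral_diff:
  fixes J :: "real \<Rightarrow> complex"
  assumes J: "\<And>x. J integrable_on {x..}" and "a \<le> b"
  shows "integral {a..} J - integral {b..} J = integral {a..b} J"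
proof -
  have 1: "J integrable_on {a..b}"
    by (rule integrable_on_subinterval[OF J[of a]]) auto
  have "{a..} = {a..b} \<union> {b..}" "{a..b} \<inter> {b..} = {b}" using \<open>a \<le> b\<close> by auto
  then have "integral {a..} J = integral {a..b} J + integral {b..} J"
    using integral_Un[OF 1 J[of b]] by simp
  then show ?thesis by simp
qed

lemma continuous_lebesgue_measurable:
  fixes f :: "real \<Rightarrow> 'a::euclidean_space"
  shows "continuous_on UNIV f \<Longrightarrow> f \<in> borel_measurable lebesgue"
  by (simp add: borel_measurable_continuous_onI measurable_completion)

text \<open>
  The class of right-hand sides. It contains the bounded functions (with \<open>H = 0\<close>) as well as the
  square integrable ones, because \<open>|g| \<le> 1 + |g|\<^sup>2\<close>.
\<close>

definition admissible :: "(real \<Rightarrow> complex) \<Rightarrow> real \<Rightarrow> (real \<Rightarrow> real) \<Rightarrow> bool" where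
  "admissible F B H \<longleftrightarrow> F \<in> borel_measurable lebesgue \<and> integrable lebesgue H \<and>
     (\<forall>x. 0 \<le> H x) \<and> 0 \<le> B \<and> (\<forall>x. norm (F x) \<le> B + H x)"

text \<open>
  The solution of \<open>u' = \<Lambda>' u + F\<close> that stays bounded at \<open>+\<infinity>\<close> when \<open>Re \<Lambda>\<close> grows linearly:
  variation of constants, starting from the value \<open>0\<close> of \<open>e\<^bsup>-\<Lambda>\<^esup> u\<close> at \<open>+\<infinity>\<close>.
\<close>

definition green :: "(real \<Rightarrow> complex) \<Rightarrow> (real \<Rightarrow> complex) \<Rightarrow> real \<Rightarrow> complex" where
  "green \<Lambda> F x = - (exp (\<Lambda> x) * integral {x..} (\<lambda>s. exp (- \<Lambda> s) * F s))"

locale growing_exponent =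
  fixes \<Lambda> l :: "real \<Rightarrow> complex" and c :: real
  assumes \<Lambda>: "\<And>x. (\<Lambda> has_vector_derivative l x) (at x)"
    and l: "continuous_on UNIV l"
    and c: "0 < c" and lc: "\<And>x. c \<le> Re (l x)"
begin

lemma Re_growth: "x \<le> s \<Longrightarrow> c * (s - x) \<le> Re (\<Lambda> s) - Re (\<Lambda> x)"
proof -
  assume "x \<le> s"
  have d: "((\<lambda>t. Re (\<Lambda> t) - c * t) has_real_derivative Re (l t) - c) (at t)" for t
    by (intro DERIV_diff DERIV_cmult_Id has_field_derivative_Re \<Lambda>)
  have "Re (\<Lambda> x) - c * x \<le> Re (\<Lambda> s) - c * s"
    by (rule DERIV_nonneg_imp_nondecreasing[OF \<open>x \<le> s\<close>]) (use d lc in \<open>fastforce intro: exI\<close>)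
  then show ?thesis by (simp add: algebra_simps)
qed

lemma continuous_\<Lambda>: "continuous_on A \<Lambda>"
  using \<Lambda> by (intro continuous_at_imp_continuous_on)
    (auto intro: has_vector_derivative_continuous)

context
  fixes F :: "real \<Rightarrow> complex" and H :: "real \<Rightarrow> real" and B :: real
  assumes adm: "admissible F B H"
begin

lemma F_measurable: "F \<in> borel_measurable lebesgue" and H_integrable: "integrable lebesgue H"
  and H_nonneg: "0 \<le> H x" and F_le: "norm (F x) \<le> B + H x"
  using adm by (simp_all add: admissible_def)

lemma H_integrable_tail: "H integrable_on {x..}"
proof -
  have "set_integrable lebesgue UNIV H" using H_integrable by (simp add: set_integrable_def)
  then have "set_integrable lebesgue {x..} H" by (rule set_integrable_subset) auto
  then show ?thesis by (rule set_lebesgue_integral_eq_integral(1))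
qed

text \<open>
  The kernel of \<open>green\<close> is at most \<open>e\<^bsup>-c(s-x)\<^esup>\<close>, so the bounded part of \<open>F\<close> contributes \<open>B/c\<close> and the
  integrable part at most its integral.
\<close>

lemma dominating_integral:
  "((\<lambda>s. B * exp (- c * (s - x)) + H s) has_integral B / c + integral {x..} H) {x..}"
proof -
  have shift: "(\<lambda>s. exp (c * x) * exp (- c * s)) = (\<lambda>s. exp (- c * (s - x)))"
    by (simp add: exp_add[symmetric] algebra_simps)
  have val: "exp (c * x) * (exp (- c * x) / c) = 1 / c"
    by (simp add: exp_minus)
  have "((\<lambda>s. exp (c * x) * exp (- c * s)) has_integral exp (c * x) * (exp (- c * x) / c)) {x..}"
    by (intro has_integral_mult_right has_integral_exp_minus_to_infinity c)
  then have "((\<lambda>s. exp (- c * (s - x))) has_integral 1 / c) {x..}"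
    unfolding shift val .
  then have "((\<lambda>s. B * exp (- c * (s - x))) has_integral B * (1 / c)) {x..}"
    by (rule has_integral_mult_right)
  moreover have "(H has_integral integral {x..} H) {x..}"
    by (rule integrable_integral[OF H_integrable_tail])
  ultimately show ?thesis by (auto intro: has_integral_add)
qed

lemma kernel_bound:
  assumes "x \<le> s"
  shows "norm (exp (\<Lambda> x) * (exp (- \<Lambda> s) * F s)) \<le> B * exp (- c * (s - x)) + H s"
proof -
  have "exp (\<Lambda> x) * (exp (- \<Lambda> s) * F s) = exp (\<Lambda> x - \<Lambda> s) * F s"
    by (simp add: exp_diff exp_minus field_simps)
  then have "norm (exp (\<Lambda> x) * (exp (- \<Lambda> s) * F s)) = exp (Re (\<Lambda> x) - Re (\<Lambda> s)) * norm (F s)"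
    by (simp only: norm_mult norm_exp_eq_Re minus_complex.simps)
  also have "\<dots> \<le> exp (- c * (s - x)) * (B + H s)"
    using Re_growth[OF assms] F_le[of s] by (intro mult_mono) auto
  also have "\<dots> \<le> B * exp (- c * (s - x)) + H s"
    using H_nonneg[of s] c assms mult_left_le[of "exp (- c * (s - x))" "H s"]
    by (simp add: distrib_left distrib_right mult.commute)
  finally show ?thesis .
qed

lemma kernel_absolutely_integrable: "(\<lambda>s. exp (- \<Lambda> s) * F s) absolutely_integrable_on {x..}"
proof (rule measurable_bounded_by_integrable_imp_absolutely_integrable)
  have [measurable]: "\<Lambda> \<in> borel_measurable lebesgue"
    by (intro continuous_lebesgue_measurable continuous_\<Lambda>)
  note F_measurable[measurable]
  have "(\<lambda>s. exp (- \<Lambda> s) * F s) \<in> borel_measurable lebesgue" by measurable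
  then show "(\<lambda>s. exp (- \<Lambda> s) * F s) \<in> borel_measurable (lebesgue_on {x..})"
    by (rule measurable_restrict_space1)
  show "(\<lambda>s. norm (exp (- \<Lambda> x)) * (B * exp (- c * (s - x)) + H s)) integrable_on {x..}"
    by (intro integrable_on_mult_right has_integral_integrable[OF dominating_integral])
  fix s assume "s \<in> {x..}"
  then have "norm (exp (- \<Lambda> x)) * norm (exp (\<Lambda> x) * (exp (- \<Lambda> s) * F s)) \<le> norm (exp (- \<Lambda> x)) * (B * exp (- c * (s - x)) + H s)"
    by (intro mult_left_mono kernel_bound) auto
  then show "norm (exp (- \<Lambda> s) * F s) \<le> norm (exp (- \<Lambda> x)) * (B * exp (- c * (s - x)) + H s)"
    by (simp add: exp_minus flip: norm_mult mult.assoc)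
qed simp

lemma kernel_integrable: "(\<lambda>s. exp (- \<Lambda> s) * F s) integrable_on {x..}"
  by (rule set_lebesgue_integral_eq_integral(1)[OF kernel_absolutely_integrable])

lemma norm_green_le: "norm (green \<Lambda> F x) \<le> B / c + (LINT s|lebesgue. H s)"
proof -
  have "norm (green \<Lambda> F x) = norm (integral {x..} (\<lambda>s. exp (\<Lambda> x) * (exp (- \<Lambda> s) * F s)))"
    by (simp add: green_def)
  also have "\<dots> \<le> integral {x..} (\<lambda>s. B * exp (- c * (s - x)) + H s)"
    by (intro Henstock_Kurzweil_Integration.integral_norm_bound_integral kernel_bound
       integrable_on_mult_right kernel_integrable has_integral_integrable[OF dominating_integral]) auto
  also have "\<dots> = B / c + integral {x..} H"
    by (rule integral_unique[OF dominating_integral])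
  also have "integral {x..} H \<le> integral UNIV H"
    using H_nonneg H_integrable H_integrable_tail by (intro integral_subset_le integrable_on_lebesgue) auto
  also have "\<dots> = (LINT s|lebesgue. H s)" by (rule integral_lebesgue[OF H_integrable])
  finally show ?thesis by simp
qed

lemma tail_difference:
  "a \<le> b \<Longrightarrow> - integral {b..} (\<lambda>s. exp (- \<Lambda> s) * F s) - - integral {a..} (\<lambda>s. exp (- \<Lambda> s) * F s)
     = integral {a..b} (\<lambda>s. exp (- \<Lambda> s) * F s)"
  using tail_integral_diff[OF kernel_integrable, of a b] by simp

lemma kernel_absolutely_integrable_interval:
   "(\<lambda>s. exp (- \<Lambda> s) * F s) absolutely_integrable_on {a..b}"
  by (rule set_integrable_subset[OF kernel_absolutely_integrable[of a]]) auto

lemma exp_\<Lambda>: "((\<lambda>x. exp (\<Lambda> x)) has_vector_derivative l x * exp (\<Lambda> x)) (at x)"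
  using field_vector_diff_chain_at[OF \<Lambda>[of x] DERIV_exp[of "\<Lambda> x"]] by (simp add: o_def)

lemma green_alt: "green \<Lambda> F = (\<lambda>x. exp (\<Lambda> x) * - integral {x..} (\<lambda>s. exp (- \<Lambda> s) * F s))"
  by (simp add: green_def fun_eq_iff)

lemma green_AC_loc: "green \<Lambda> F \<in> AC_loc"
  unfolding green_alt
proof (rule AC_loc_mult)
  have "continuous_on UNIV (\<lambda>x. l x * exp (\<Lambda> x))"
    using l continuous_\<Lambda> by (intro continuous_intros)
  then show "(\<lambda>x. exp (\<Lambda> x)) \<in> AC_loc"
    by (rule AC_loc_continuous_derivative[OF exp_\<Lambda>])
  show "(\<lambda>x. - integral {x..} (\<lambda>s. exp (- \<Lambda> s) * F s)) \<in> AC_loc"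
    by (rule indefinite_integral_AC_loc[OF kernel_absolutely_integrable_interval tail_difference])
qed

lemma green_has_derivative:
  "AE x in lebesgue. (green \<Lambda> F has_vector_derivative l x * green \<Lambda> F x + F x) (at x)"
proof -
  have "AE x in lebesgue. ((\<lambda>x. - integral {x..} (\<lambda>s. exp (- \<Lambda> s) * F s))
      has_vector_derivative exp (- \<Lambda> x) * F x) (at x)"
    by (rule indefinite_integral_has_derivative_AE[OF _ tail_difference])
      (rule set_lebesgue_integral_eq_integral(1)[OF kernel_absolutely_integrable_interval])
  then show ?thesis
  proof eventually_elim
    case (elim x)
    from has_vector_derivative_mult[OF exp_\<Lambda> elim] show ?case
      unfolding green_alt by (simp add: exp_minus algebra_simps)
  qed
qed


lemma admissible_absolutely_integrable_interval: "F absolutely_integrable_on {a..b}"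
proof (rule measurable_bounded_by_integrable_imp_absolutely_integrable)
  show "F \<in> borel_measurable (lebesgue_on {a..b})"
    using F_measurable by (rule measurable_restrict_space1)
  show "(\<lambda>x. B + H x) integrable_on {a..b}"
    using H_integrable_tail[of a] by (intro integrable_add) (auto intro: integrable_on_subinterval)
qed (use F_le in auto)

end

lemma green_diff:
  assumes "admissible F1 B1 H1" "admissible F2 B2 H2"
  shows "green \<Lambda> F1 x - green \<Lambda> F2 x = green \<Lambda> (\<lambda>x. F1 x - F2 x) x"
proof -
  have "integral {x..} (\<lambda>s. exp (- \<Lambda> s) * (F1 s - F2 s))
      = integral {x..} (\<lambda>s. exp (- \<Lambda> s) * F1 s) - integral {x..} (\<lambda>s. exp (- \<Lambda> s) * F2 s)"
    unfolding right_diff_distrib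
    by (intro Henstock_Kurzweil_Integration.integral_diff kernel_integrable[OF assms(1)] kernel_integrable[OF assms(2)])
  then show ?thesis unfolding green_def by (simp only: right_diff_distrib) simp
qed

end

text \<open>
  Reflection turns the growing equation into the decaying one. It is proved through the
  characterization by indefinite integrals, for which the change of variables is available.
\<close>

lemma AC_loc_reflect:
  fixes U :: "real \<Rightarrow> complex"
  assumes U: "U \<in> AC_loc" "AE x in lebesgue. (U has_vector_derivative f x) (at x)"
    and f: "\<And>a b. f absolutely_integrable_on {a..b}"
  shows "(\<lambda>x. U (- x)) \<in> AC_loc"
    and "AE x in lebesgue. ((\<lambda>x. U (- x)) has_vector_derivative - f (- x)) (at x)"
proof -
  have f': "(\<lambda>x. - f (- x)) absolutely_integrable_on {a..b}" for a b
    using f[of "-b" "-a"] absolutely_integrable_reflect_real[where f=f and a="-b" and b="-a"]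
    by (simp add: set_integrable_def)
  have U': "U (- b) - U (- a) = integral {a..b} (\<lambda>x. - f (- x))" if "a \<le> b" for a b
  proof -
    have "(f has_integral U (-a) - U (-b)) {-b..-a}"
      using AC_loc_has_integral[OF U, of "-b" "-a"] that by simp
    then have "((\<lambda>x. f (- x)) has_integral U (-a) - U (-b)) {a..b}"
      using Henstock_Kurzweil_Integration.has_integral_reflect_real[where f=f and a="-b" and b="-a"] by simp
    from integral_unique[OF has_integral_neg[OF this]] show ?thesis by simp
  qed
  show "(\<lambda>x. U (- x)) \<in> AC_loc"
    by (rule indefinite_integral_AC_loc[OF f' U'])
  show "AE x in lebesgue. ((\<lambda>x. U (- x)) has_vector_derivative - f (- x)) (at x)"
    by (rule indefinite_integral_has_derivative_AE[OF set_lebesgue_integral_eq_integral(1)[OF f'] U'])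
qed

lemma integral_reflect_lebesgue:
  fixes H :: "real \<Rightarrow> real"
  assumes "integrable lebesgue H"
  shows "integrable lebesgue (\<lambda>x. H (- x))" "(LINT x|lebesgue. H (- x)) = (LINT x|lebesgue. H x)"
proof -
  have H: "H absolutely_integrable_on UNIV" using assms by (simp add: set_integrable_def)
  have "surj (uminus :: real \<Rightarrow> real)" by (rule surj_uminus)
  then have *: "(\<lambda>x. H (- x)) absolutely_integrable_on UNIV \<and> integral UNIV (\<lambda>x. H (- x)) = integral UNIV H"
    using has_absolute_integral_reflect_real[of UNIV UNIV H "integral UNIV H"] H by simp
  then show 1: "integrable lebesgue (\<lambda>x. H (- x))" by (simp add: set_integrable_def)
  show "(LINT x|lebesgue. H (- x)) = (LINT x|lebesgue. H x)"
    using * integral_lebesgue[OF 1] integral_lebesgue[OF assms] by simp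
qed

lemma admissible_reflect:
  assumes "admissible F B H" shows "admissible (\<lambda>x. - F (- x)) B (\<lambda>x. H (- x))"
proof -
  have "F \<in> borel_measurable lebesgue" using assms by (simp add: admissible_def)
  from measurable_compose[OF lebesgue_measurable_scaling[of "-1"] this]
  have "(\<lambda>x. F (- x)) \<in> borel_measurable lebesgue" by simp
  then show ?thesis using assms by (auto simp: admissible_def integral_reflect_lebesgue)
qed

text \<open>
  The bounded solution of \<open>w' = - \<Lambda>' w + F\<close>: its reflection solves
  \<open>w' = \<Lambda>'(-x) w - F(-x)\<close>, and \<open>-\<Lambda>(-x)\<close> is a primitive of the coefficient.
\<close>

definition green_stable :: "(real \<Rightarrow> complex) \<Rightarrow> (real \<Rightarrow> complex) \<Rightarrow> real \<Rightarrow> complex" where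
  "green_stable \<Lambda> F x = green (\<lambda>s. - \<Lambda> (- s)) (\<lambda>s. - F (- s)) (- x)"

context growing_exponent
begin

lemma reflected: "growing_exponent (\<lambda>s. - \<Lambda> (- s)) (\<lambda>s. l (- s)) c"
proof
  show "((\<lambda>s. - \<Lambda> (- s)) has_vector_derivative l (- x)) (at x)" for x
  proof -
    have "(uminus has_vector_derivative - 1) (at x)"
      using has_vector_derivative_minus[OF has_vector_derivative_id] by simp
    from vector_diff_chain_at[OF this \<Lambda>[of "- x"]]
    have "((\<lambda>s. \<Lambda> (- s)) has_vector_derivative - l (- x)) (at x)" by (simp add: o_def)
    from has_vector_derivative_minus[OF this] show ?thesis by simp
  qed
  show "continuous_on UNIV (\<lambda>s. l (- s))"
    by (rule continuous_on_compose2[OF l]) (auto intro: continuous_intros)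
qed (use c lc in auto)

lemma norm_green_stable_le:
  assumes "admissible F B H"
  shows "norm (green_stable \<Lambda> F x) \<le> B / c + (LINT s|lebesgue. H s)"
proof -
  have "(LINT s|lebesgue. H (- s)) = (LINT s|lebesgue. H s)"
    using assms by (intro integral_reflect_lebesgue) (simp add: admissible_def)
  then show ?thesis
    using growing_exponent.norm_green_le[OF reflected, OF admissible_reflect[OF assms], of "- x"]
    by (simp add: green_stable_def)
qed

lemma
  assumes adm: "admissible F B H"
  shows green_stable_AC_loc: "green_stable \<Lambda> F \<in> AC_loc"
    and green_stable_has_derivative:
    "AE x in lebesgue. (green_stable \<Lambda> F has_vector_derivative - l x * green_stable \<Lambda> F x + F x) (at x)"
proof -
  let ?U = "green (\<lambda>s. - \<Lambda> (- s)) (\<lambda>s. - F (- s))"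
  note adm' = admissible_reflect[OF adm]
  have AC: "?U \<in> AC_loc" by (rule growing_exponent.green_AC_loc[OF reflected, OF adm'])
  have "continuous_on {a..b} (\<lambda>x. l (- x) * ?U x)" for a b
    by (intro continuous_intros AC_loc_continuous[OF AC] continuous_on_subset[OF growing_exponent.l[OF reflected]]) auto
  then have "(\<lambda>x. l (- x) * ?U x + - F (- x)) absolutely_integrable_on {a..b}" for a b
    by (intro set_integral_add absolutely_integrable_continuous_real
        growing_exponent.admissible_absolutely_integrable_interval[OF reflected, OF adm'])
  note AC_loc_reflect[OF AC growing_exponent.green_has_derivative[OF reflected, OF adm'] this]
  moreover have "green_stable \<Lambda> F = (\<lambda>x. ?U (- x))" by (simp add: green_stable_def fun_eq_iff)
  ultimately show "green_stable \<Lambda> F \<in> AC_loc"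
    "AE x in lebesgue. (green_stable \<Lambda> F has_vector_derivative - l x * green_stable \<Lambda> F x + F x) (at x)"
    by simp_all
qed

lemma green_stable_diff:
  assumes "admissible F1 B1 H1" "admissible F2 B2 H2"
  shows "green_stable \<Lambda> F1 x - green_stable \<Lambda> F2 x = green_stable \<Lambda> (\<lambda>x. F1 x - F2 x) x"
  using growing_exponent.green_diff[OF reflected, OF assms[THEN admissible_reflect], of "- x"]
  by (simp add: green_stable_def)

end

section \<open>The diagonalized system\<close>

lemma integrable_if_bounded_on_intervals:
  fixes V :: "real \<Rightarrow> real"
  assumes V: "continuous_on UNIV V" "\<And>x. 0 \<le> V x"
    and R: "\<And>n::nat. integral {- real n..real n} V \<le> R"
  shows "integrable lebesgue V \<and> (LINT x|lebesgue. V x) \<le> R"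
proof -
  define f where "f = (\<lambda>n::nat. \<lambda>x. indicator {- real n..real n} x * V x)"
  have ai: "V absolutely_integrable_on {- real n..real n}" for n
    using V by (intro absolutely_integrable_continuous_real) (auto intro: continuous_on_subset)
  have int: "integrable lebesgue (f n)" for n
    using ai[of n] by (simp add: f_def set_integrable_def)
  have val: "(LINT x|lebesgue. f n x) = integral {- real n..real n} V" for n
    using set_lebesgue_integral_eq_integral(2)[OF ai[of n]] by (simp add: f_def set_lebesgue_integral_def)
  have mono: "mono (\<lambda>n. f n x)" for x
    using V by (intro monoI) (auto simp: f_def indicator_def)
  have lim: "(\<lambda>n. f n x) \<longlonglongrightarrow> V x" for x
  proof (rule tendsto_eventually)
    show "\<forall>\<^sub>F n in sequentially. f n x = V x"
      using eventually_ge_at_top[of "nat \<lceil>\<bar>x\<bar>\<rceil>"]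
      by eventually_elim (auto simp: f_def indicator_def; linarith)
  qed
  have "incseq (\<lambda>n. LINT x|lebesgue. f n x)"
    using mono int by (intro incseq_SucI integral_mono) (auto simp: mono_def)
  moreover have "(LINT x|lebesgue. f n x) \<le> R" for n using val R by simp
  ultimately obtain L where L: "(\<lambda>n. LINT x|lebesgue. f n x) \<longlonglongrightarrow> L" "L \<le> R"
    by (metis incseq_convergent LIMSEQ_le_const2)
  have m: "V \<in> borel_measurable lebesgue" by (rule continuous_lebesgue_measurable[OF V(1)])
  have "integrable lebesgue V" "(LINT x|lebesgue. V x) = L"
    using integrable_monotone_convergence[OF int _ _ L(1) m] integral_monotone_convergence[OF int _ _ L(1) m]
      mono lim by auto
  then show ?thesis using L by simp
qed

text \<open>
  The boundary terms of the energy identity cannot be controlled by a limit, as a square integrable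
  function need not tend to \<open>0\<close>; but it is small at arbitrarily distant points.
\<close>

lemma integrable_small_value:
  fixes V :: "real \<Rightarrow> real"
  assumes V: "integrable lebesgue V" "\<And>x. 0 \<le> V x" and e: "e > 0"
  shows "\<exists>x\<ge>N. V x < e"
proof (rule ccontr)
  assume "\<not> (\<exists>x\<ge>N. V x < e)"
  then have ge: "V x \<ge> e" if "x \<ge> N" for x using that by force
  obtain n :: nat where n: "(LINT x|lebesgue. V x) / e < real n" using reals_Archimedean2 by blast
  have "e * real n = (LINT x|lebesgue. e * indicator {N..N + real n} x)" by simp
  also have "\<dots> \<le> (LINT x|lebesgue. V x)"
  proof (rule integral_mono[OF _ V(1)])
    show "integrable lebesgue (\<lambda>x. e * indicator {N..N + real n} x)"
      by (intro integrable_mult_right integrable_real_indicator) auto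
    show "e * indicator {N..N + real n} x \<le> V x" for x
      using ge V(2) by (auto simp: indicator_def)
  qed
  finally show False using n e by (simp add: field_simps)
qed

text \<open>
  Differentiating \<open>|u|\<^sup>2 - |w|\<^sup>2\<close> along \<open>u' = l u + r\<close>, \<open>w' = - l w + s\<close>: both equations contribute
  \<open>2 Re l\<close> with a positive sign. A quarter of the resulting \<open>2c(|u|\<^sup>2 + |w|\<^sup>2)\<close> absorbs the coupling
  and another quarter, by Young's inequality, the source terms \<open>f\<close> and \<open>g\<close>.
\<close>

lemma energy_pointwise:
  fixes u w r s l :: complex
  assumes l: "c \<le> Re l" and c: "0 < c" and \<eta>: "0 \<le> \<eta>" "8 * \<eta> \<le> c"
    and r: "norm r \<le> \<eta> * (norm u + norm w) + f" and s: "norm s \<le> \<eta> * (norm u + norm w) + g"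
  shows "c * ((norm u)\<^sup>2 + (norm w)\<^sup>2) - 2 / c * (f\<^sup>2 + g\<^sup>2)
       \<le> 2 * Re (cnj u * (l * u + r)) - 2 * Re (cnj w * (- l * w + s))"
proof -
  define U W where "U = norm u" and "W = norm w"
  have UW: "0 \<le> U" "0 \<le> W" by (auto simp: U_def W_def)
  have sq: "Re (cnj z * (l * z)) = Re l * (norm z)\<^sup>2" for z
    by (simp only: cmod_power2) (simp add: algebra_simps power2_eq_square)
  have e1: "Re (cnj u * (l * u + r)) \<ge> c * U\<^sup>2 - U * (\<eta> * (U + W) + f)"
  proof -
    have "\<bar>Re (cnj u * r)\<bar> \<le> norm (cnj u * r)" by (rule abs_Re_le_cmod)
    also have "\<dots> \<le> U * (\<eta> * (U + W) + f)"
      using r by (simp add: norm_mult U_def W_def mult_left_mono)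
    finally have "Re (cnj u * r) \<ge> - (U * (\<eta> * (U + W) + f))" by simp
    moreover have "c * U\<^sup>2 \<le> Re l * U\<^sup>2" using l by (intro mult_right_mono) auto
    ultimately show ?thesis using sq[of u] by (simp add: distrib_left U_def del: mult_minus_left)
  qed
  have e2: "Re (cnj w * (- l * w + s)) \<le> - (c * W\<^sup>2) + W * (\<eta> * (U + W) + g)"
  proof -
    have "\<bar>Re (cnj w * s)\<bar> \<le> norm (cnj w * s)" by (rule abs_Re_le_cmod)
    also have "\<dots> \<le> W * (\<eta> * (U + W) + g)"
      using s by (simp add: norm_mult U_def W_def mult_left_mono)
    finally have "Re (cnj w * s) \<le> W * (\<eta> * (U + W) + g)" by simp
    moreover have "c * W\<^sup>2 \<le> Re l * W\<^sup>2" using l by (intro mult_right_mono) auto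
    moreover have "cnj w * (- l * w + s) = - (cnj w * (l * w)) + cnj w * s" by (simp add: algebra_simps)
    ultimately show ?thesis using sq[of w] by (simp only: plus_complex.simps uminus_complex.simps W_def)
  qed
  have young: "2 * (X * t) \<le> c / 2 * X\<^sup>2 + 2 / c * t\<^sup>2" for X t :: real
  proof -
    have "0 \<le> (c * X - 2 * t)\<^sup>2 / (2 * c)" using c by simp
    also have "\<dots> = c / 2 * X\<^sup>2 + 2 / c * t\<^sup>2 - 2 * (X * t)"
      using c by (simp add: power2_eq_square field_simps)
    finally show ?thesis by simp
  qed
  have "2 * (\<eta> * (U + W)\<^sup>2) \<le> \<eta> * (4 * (U\<^sup>2 + W\<^sup>2))"
  proof -
    have "(U + W)\<^sup>2 \<le> 2 * (U\<^sup>2 + W\<^sup>2)"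
      using zero_le_power2[of "U - W"] by (simp add: power2_eq_square algebra_simps)
    from mult_left_mono[OF this, of "2 * \<eta>"] \<eta> show ?thesis by (simp add: algebra_simps)
  qed
  also have "\<dots> \<le> c / 2 * (U\<^sup>2 + W\<^sup>2)"
    using mult_right_mono[OF \<eta>(2), of "(U\<^sup>2 + W\<^sup>2) / 2"] by (simp add: algebra_simps)
  finally have "2 * (\<eta> * (U + W)\<^sup>2) \<le> c / 2 * (U\<^sup>2 + W\<^sup>2)" .
  then have "2 * (U * (\<eta> * (U + W))) + 2 * (W * (\<eta> * (U + W))) \<le> c / 2 * (U\<^sup>2 + W\<^sup>2)"
    by (simp add: power2_eq_square algebra_simps)
  then show ?thesis
    using e1 e2 young[of U f] young[of W g] unfolding U_def[symmetric] W_def[symmetric]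
    by (simp add: distrib_left algebra_simps)
qed

definition first_order_solution where
  "first_order_solution h \<zeta> p q g1 g2 v1 v2 \<longleftrightarrow> v1 \<in> AC_loc \<and> v2 \<in> AC_loc \<and>
     (AE x in lebesgue.
        (v1 has_vector_derivative (- \<zeta> * v1 x + q x * v2 x + g1 x) / complex_of_real h) (at x) \<and>
        (v2 has_vector_derivative (p x * v1 x + \<zeta> * v2 x + g2 x) / complex_of_real h) (at x))"

lemma norm_sq_combination:
  fixes x y :: complex
  assumes "norm t \<le> K"
  shows "(norm (x + t * y))\<^sup>2 \<le> 2 * (norm x)\<^sup>2 + 2 * K\<^sup>2 * (norm y)\<^sup>2"
proof -
  have "norm (x + t * y) \<le> norm x + K * norm y"
    using assms norm_triangle_ineq[of x "t * y"] mult_right_mono[OF assms, of "norm y"]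
    by (simp add: norm_mult)
  then have "(norm (x + t * y))\<^sup>2 \<le> (norm x + K * norm y)\<^sup>2" by (intro power_mono) auto
  also have "\<dots> \<le> 2 * (norm x)\<^sup>2 + 2 * K\<^sup>2 * (norm y)\<^sup>2"
    using zero_le_power2[of "norm x - K * norm y"] by (simp add: power2_eq_square algebra_simps)
  finally show ?thesis .
qed

text \<open>
  The algebra and the bounds that make the change of unknowns \<open>u = v\<^sub>2 + b v\<^sub>1\<close>, \<open>w = v\<^sub>1 - a v\<^sub>2\<close>
  diagonalize the system up to terms of order \<open>h\<close>. The four identities after the bounds say that
  \<open>(b, 1)\<close> and \<open>(1, -a)\<close> are left eigenvectors of \<open>((-\<zeta>, q), (p, \<zeta>))\<close> for \<open>l\<close> and \<open>-l\<close>; \<open>\<kappa>\<close> is the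
  inverse of the determinant of the transformation. The assumption \<open>small\<close> makes the coupling
  weak enough both for the energy inequality and for the contraction.
\<close>

locale diagonalized_system =
  fixes h c K k M :: real and \<zeta> :: complex and p q a b a' b' l \<kappa> :: "real \<Rightarrow> complex"
  assumes h: "0 < h" and c: "0 < c" and K: "0 \<le> K" and k: "0 < k" and M: "0 \<le> M"
    and small: "8 * (h * M * k * (1 + K)) \<le> c"
    and a_AC: "a \<in> AC_loc" and b_AC: "b \<in> AC_loc" and l_cont: "continuous_on UNIV l"
    and a_der: "AE x in lebesgue. (a has_vector_derivative a' x) (at x)"
    and b_der: "AE x in lebesgue. (b has_vector_derivative b' x) (at x)"
    and a'_meas: "a' \<in> borel_measurable lebesgue" and b'_meas: "b' \<in> borel_measurable lebesgue"
    and a_le: "\<And>x. norm (a x) \<le> K" and b_le: "\<And>x. norm (b x) \<le> K"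
    and a'_le: "\<And>x. norm (a' x) \<le> M" and b'_le: "\<And>x. norm (b' x) \<le> M"
    and \<kappa>_le: "\<And>x. norm (\<kappa> x) \<le> k" and l_ge: "\<And>x. c \<le> Re (l x)"
    and ap: "\<And>x. a x * p x = l x - \<zeta>" and bq: "\<And>x. b x * q x = l x - \<zeta>"
    and q_eq: "\<And>x. q x - \<zeta> * a x = l x * a x" and p_eq: "\<And>x. p x - \<zeta> * b x = l x * b x"
    and \<kappa>_eq: "\<And>x. \<kappa> x * (1 + a x * b x) = 1"
begin

lemma inverse_transform_transform:
  assumes "u = y + b x * z" "w = z - a x * y"
  shows "\<kappa> x * (w + a x * u) = z" "\<kappa> x * (u - b x * w) = y"
proof -
  have "\<kappa> x * (w + a x * u) = (\<kappa> x * (1 + a x * b x)) * z"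
    unfolding assms by (simp add: algebra_simps)
  then show "\<kappa> x * (w + a x * u) = z" by (simp add: \<kappa>_eq)
  have "\<kappa> x * (u - b x * w) = (\<kappa> x * (1 + a x * b x)) * y"
    unfolding assms by (simp add: algebra_simps)
  then show "\<kappa> x * (u - b x * w) = y" by (simp add: \<kappa>_eq)
qed

lemma transform_inverse_transform:
  assumes "z = \<kappa> x * (w + a x * u)" "y = \<kappa> x * (u - b x * w)"
  shows "y + b x * z = u" "z - a x * y = w"
proof -
  have "y + b x * z = (\<kappa> x * (1 + a x * b x)) * u"
    unfolding assms by (simp add: algebra_simps)
  then show "y + b x * z = u" by (simp add: \<kappa>_eq)
  have "z - a x * y = (\<kappa> x * (1 + a x * b x)) * w"
    unfolding assms by (simp add: algebra_simps)
  then show "z - a x * y = w" by (simp add: \<kappa>_eq)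
qed

lemma diagonalize:
  "(p x * z + \<zeta> * y + g2) + b x * (- \<zeta> * z + q x * y + g1) = l x * (y + b x * z) + (g2 + b x * g1)"
  "(- \<zeta> * z + q x * y + g1) - a x * (p x * z + \<zeta> * y + g2) = - l x * (z - a x * y) + (g1 - a x * g2)"
proof -
  have "(p x * z + \<zeta> * y + g2) + b x * (- \<zeta> * z + q x * y + g1)
      = (p x - \<zeta> * b x) * z + (\<zeta> + b x * q x) * y + (g2 + b x * g1)"
    by (simp add: algebra_simps)
  then show "(p x * z + \<zeta> * y + g2) + b x * (- \<zeta> * z + q x * y + g1) = l x * (y + b x * z) + (g2 + b x * g1)"
    by (simp add: p_eq bq algebra_simps)
  have "(- \<zeta> * z + q x * y + g1) - a x * (p x * z + \<zeta> * y + g2)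
      = - (\<zeta> + a x * p x) * z + (q x - \<zeta> * a x) * y + (g1 - a x * g2)"
    by (simp add: algebra_simps)
  then show "(- \<zeta> * z + q x * y + g1) - a x * (p x * z + \<zeta> * y + g2) = - l x * (z - a x * y) + (g1 - a x * g2)"
    by (simp add: q_eq ap algebra_simps)
qed

lemma norm_inverse_transform_le:
  assumes "norm u \<le> m" "norm w \<le> m'"
  shows "norm (\<kappa> x * (w + a x * u)) \<le> k * (m' + K * m)" "norm (\<kappa> x * (u - b x * w)) \<le> k * (m + K * m')"
proof -
  have m: "0 \<le> m" "0 \<le> m'" using assms norm_ge_zero order_trans by blast+
  have "norm (w + a x * u) \<le> m' + K * m"
    using assms a_le[of x] K m norm_triangle_ineq[of w "a x * u"] mult_mono[of "norm (a x)" K "norm u" m]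
    by (simp add: norm_mult)
  then show "norm (\<kappa> x * (w + a x * u)) \<le> k * (m' + K * m)"
    using \<kappa>_le[of x] k by (simp add: norm_mult mult_mono)
  have "norm (u - b x * w) \<le> m + K * m'"
    using assms b_le[of x] K m norm_triangle_ineq4[of u "b x * w"] mult_mono[of "norm (b x)" K "norm w" m']
    by (simp add: norm_mult)
  then show "norm (\<kappa> x * (u - b x * w)) \<le> k * (m + K * m')"
    using \<kappa>_le[of x] k by (simp add: norm_mult mult_mono)
qed

definition "\<alpha> = c / (2 * k\<^sup>2 * (1 + K\<^sup>2))"
definition "\<beta> = 4 * (1 + K\<^sup>2) / c"

lemma \<alpha>_pos: "\<alpha> > 0" using c k by (auto simp: \<alpha>_def add_pos_nonneg)
lemma \<beta>_nonneg: "\<beta> \<ge> 0" using c by (auto simp: \<beta>_def)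

definition energy where
  "energy v1 v2 x = (norm (v2 x + b x * v1 x))\<^sup>2 - (norm (v1 x - a x * v2 x))\<^sup>2"

lemma norm_sq_uw_le:
  "(norm (y + b x * z))\<^sup>2 + (norm (z - a x * y))\<^sup>2 \<le> 2 * (1 + K\<^sup>2) * ((norm z)\<^sup>2 + (norm y)\<^sup>2)"
  using norm_sq_combination[OF b_le[of x], of y z] norm_sq_combination[of "- a x" K z y] a_le[of x]
  by (simp add: algebra_simps)

lemma norm_sq_v_le:
  "(norm z)\<^sup>2 + (norm y)\<^sup>2 \<le> 2 * k\<^sup>2 * (1 + K\<^sup>2) * ((norm (y + b x * z))\<^sup>2 + (norm (z - a x * y))\<^sup>2)"
proof -
  define u w where "u = y + b x * z" and "w = z - a x * y"
  have z: "z = \<kappa> x * (w + a x * u)" and y: "y = \<kappa> x * (u + (- b x) * w)"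
    using inverse_transform_transform[OF u_def w_def] by simp_all
  have kk: "(norm (\<kappa> x))\<^sup>2 \<le> k\<^sup>2" using \<kappa>_le[of x] by (intro power_mono) auto
  have "(norm z)\<^sup>2 + (norm y)\<^sup>2 = (norm (\<kappa> x))\<^sup>2 * ((norm (w + a x * u))\<^sup>2 + (norm (u + (- b x) * w))\<^sup>2)"
    using arg_cong[OF z, of norm, unfolded norm_mult] arg_cong[OF y, of norm, unfolded norm_mult]
    by (simp only: norm_mult power_mult_distrib distrib_left)
  also have "\<dots> \<le> k\<^sup>2 * ((2 * (norm w)\<^sup>2 + 2 * K\<^sup>2 * (norm u)\<^sup>2) + (2 * (norm u)\<^sup>2 + 2 * K\<^sup>2 * (norm w)\<^sup>2))"
    using a_le[of x] b_le[of x] by (intro mult_mono kk add_mono norm_sq_combination) auto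
  also have "\<dots> = 2 * k\<^sup>2 * (1 + K\<^sup>2) * ((norm u)\<^sup>2 + (norm w)\<^sup>2)" by (simp add: algebra_simps)
  finally show ?thesis by (simp add: u_def w_def)
qed

lemma abs_energy_le: "\<bar>energy v1 v2 x\<bar> \<le> 2 * (1 + K\<^sup>2) * ((norm (v1 x))\<^sup>2 + (norm (v2 x))\<^sup>2)"
  using norm_sq_uw_le[of "v2 x" x "v1 x"] by (simp add: energy_def abs_le_iff)
    (smt (verit) zero_le_power2)

lemma energy_density_ge:
  fixes z y g1 g2 :: complex and x :: real
  defines "u \<equiv> y + b x * z" and "w \<equiv> z - a x * y"
  shows "\<alpha> * ((norm z)\<^sup>2 + (norm y)\<^sup>2) - \<beta> * ((norm g1)\<^sup>2 + (norm g2)\<^sup>2)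
    \<le> 2 * Re (cnj u * (l x * u + (h * b' x * z + (g2 + b x * g1))))
     - 2 * Re (cnj w * (- l x * w + (- h * a' x * y + (g1 - a x * g2))))"
proof -
  define \<eta> where "\<eta> = h * M * k * (1 + K)"
  have v: "norm z \<le> k * (1 + K) * (norm u + norm w)" "norm y \<le> k * (1 + K) * (norm u + norm w)"
  proof -
    have "k * (norm w + K * norm u) \<le> k * ((1 + K) * (norm u + norm w))"
      "k * (norm u + K * norm w) \<le> k * ((1 + K) * (norm u + norm w))"
      using K k by (intro mult_left_mono; simp add: algebra_simps)+
    moreover have "norm z \<le> k * (norm w + K * norm u)" "norm y \<le> k * (norm u + K * norm w)"
      using norm_inverse_transform_le[of u "norm u" w "norm w" x]
        inverse_transform_transform[OF u_def[THEN meta_eq_to_obj_eq] w_def[THEN meta_eq_to_obj_eq]] by auto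
    ultimately show "norm z \<le> k * (1 + K) * (norm u + norm w)" "norm y \<le> k * (1 + K) * (norm u + norm w)"
      unfolding mult.assoc by (blast intro: order_trans)+
  qed
  have n: "norm (h * d * t + s) \<le> \<eta> * (norm u + norm w) + norm s"
    if "norm d \<le> M" "norm t \<le> k * (1 + K) * (norm u + norm w)" for d t s :: complex
  proof -
    have "norm (h * d * t) \<le> h * M * (k * (1 + K) * (norm u + norm w))"
      using that h M by (simp add: norm_mult mult_mono)
    then show ?thesis using norm_triangle_ineq[of "h * d * t" s] by (simp add: \<eta>_def mult.assoc)
  qed
  have "\<alpha> * ((norm z)\<^sup>2 + (norm y)\<^sup>2) \<le> \<alpha> * (2 * k\<^sup>2 * (1 + K\<^sup>2) * ((norm u)\<^sup>2 + (norm w)\<^sup>2))"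
    using norm_sq_v_le[of z y x] \<alpha>_pos by (intro mult_left_mono) (auto simp: u_def w_def)
  also have "\<dots> = c * ((norm u)\<^sup>2 + (norm w)\<^sup>2)"
  proof -
    have "1 + K\<^sup>2 \<noteq> 0" by (smt (verit) zero_le_power2)
    then show ?thesis using k by (simp add: \<alpha>_def)
  qed
  finally have 1: "\<alpha> * ((norm z)\<^sup>2 + (norm y)\<^sup>2) \<le> c * ((norm u)\<^sup>2 + (norm w)\<^sup>2)" .
  have "2 / c * ((norm (g2 + b x * g1))\<^sup>2 + (norm (g1 - a x * g2))\<^sup>2)
     \<le> 2 / c * (2 * (1 + K\<^sup>2) * ((norm g1)\<^sup>2 + (norm g2)\<^sup>2))"
    using c by (intro mult_left_mono norm_sq_uw_le) auto
  also have "\<dots> = \<beta> * ((norm g1)\<^sup>2 + (norm g2)\<^sup>2)" by (simp add: \<beta>_def)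
  finally have 2: "2 / c * ((norm (g2 + b x * g1))\<^sup>2 + (norm (g1 - a x * g2))\<^sup>2) \<le> \<beta> * ((norm g1)\<^sup>2 + (norm g2)\<^sup>2)" .
  have "c * ((norm u)\<^sup>2 + (norm w)\<^sup>2) - 2 / c * ((norm (g2 + b x * g1))\<^sup>2 + (norm (g1 - a x * g2))\<^sup>2)
    \<le> 2 * Re (cnj u * (l x * u + (h * b' x * z + (g2 + b x * g1))))
     - 2 * Re (cnj w * (- l x * w + (h * (- a' x) * y + (g1 - a x * g2))))"
    using small h M k K
    by (intro energy_pointwise[OF l_ge c, where \<eta>=\<eta>] n v) (auto simp: \<eta>_def a'_le b'_le)
  then show ?thesis using 1 2 by simp
qed

lemma transformed_derivative:
  assumes v1: "(v1 has_vector_derivative (- \<zeta> * v1 x + q x * v2 x + g1 x) / complex_of_real h) (at x)"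
    and v2: "(v2 has_vector_derivative (p x * v1 x + \<zeta> * v2 x + g2 x) / complex_of_real h) (at x)"
    and a: "(a has_vector_derivative a' x) (at x)" and b: "(b has_vector_derivative b' x) (at x)"
  shows "((\<lambda>x. v2 x + b x * v1 x) has_vector_derivative
       (l x * (v2 x + b x * v1 x) + (h * b' x * v1 x + (g2 x + b x * g1 x))) / h) (at x)"
    and "((\<lambda>x. v1 x - a x * v2 x) has_vector_derivative
       (- l x * (v1 x - a x * v2 x) + (- h * a' x * v2 x + (g1 x - a x * g2 x))) / h) (at x)"
proof -
  have h0: "complex_of_real h \<noteq> 0" using h by simp
  have "(p x * v1 x + \<zeta> * v2 x + g2 x) / h + (b x * ((- \<zeta> * v1 x + q x * v2 x + g1 x) / h) + b' x * v1 x)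
     = ((p x * v1 x + \<zeta> * v2 x + g2 x) + b x * (- \<zeta> * v1 x + q x * v2 x + g1 x) + h * b' x * v1 x) / h"
    using h0 by (simp add: field_simps)
  also have "\<dots> = (l x * (v2 x + b x * v1 x) + (h * b' x * v1 x + (g2 x + b x * g1 x))) / h"
    by (simp only: diagonalize) (simp add: algebra_simps)
  finally show "((\<lambda>x. v2 x + b x * v1 x) has_vector_derivative
       (l x * (v2 x + b x * v1 x) + (h * b' x * v1 x + (g2 x + b x * g1 x))) / h) (at x)"
    using has_vector_derivative_add[OF v2 has_vector_derivative_mult[OF b v1]] by simp
  have "(- \<zeta> * v1 x + q x * v2 x + g1 x) / h - (a x * ((p x * v1 x + \<zeta> * v2 x + g2 x) / h) + a' x * v2 x)
     = ((- \<zeta> * v1 x + q x * v2 x + g1 x) - a x * (p x * v1 x + \<zeta> * v2 x + g2 x) - h * a' x * v2 x) / h"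
    using h0 by (simp add: field_simps)
  also have "\<dots> = (- l x * (v1 x - a x * v2 x) + (- h * a' x * v2 x + (g1 x - a x * g2 x))) / h"
    by (simp only: diagonalize) (simp add: algebra_simps)
  finally show "((\<lambda>x. v1 x - a x * v2 x) has_vector_derivative
       (- l x * (v1 x - a x * v2 x) + (- h * a' x * v2 x + (g1 x - a x * g2 x))) / h) (at x)"
    using has_vector_derivative_diff[OF v1 has_vector_derivative_mult[OF a v2]] by simp
qed

text \<open>
  The energy need not be differentiable everywhere, but it is locally absolutely continuous, so
  the pointwise lower bound of its derivative can be integrated.
\<close>

lemma energy_inequality:
  assumes sol: "first_order_solution h \<zeta> p q g1 g2 v1 v2"
    and g: "integrable lebesgue (\<lambda>x. (norm (g1 x))\<^sup>2 + (norm (g2 x))\<^sup>2)" and ts: "s \<le> t"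
  shows "\<alpha> * integral {s..t} (\<lambda>x. (norm (v1 x))\<^sup>2 + (norm (v2 x))\<^sup>2)
     \<le> h * (energy v1 v2 t - energy v1 v2 s) + \<beta> * (LINT x|lebesgue. (norm (g1 x))\<^sup>2 + (norm (g2 x))\<^sup>2)"
proof -
  define u w where "u = (\<lambda>x. v2 x + b x * v1 x)" and "w = (\<lambda>x. v1 x - a x * v2 x)"
  define V G where "V = (\<lambda>x. (norm (v1 x))\<^sup>2 + (norm (v2 x))\<^sup>2)" and "G = (\<lambda>x. (norm (g1 x))\<^sup>2 + (norm (g2 x))\<^sup>2)"
  define u' where "u' = (\<lambda>x. (l x * u x + (h * b' x * v1 x + (g2 x + b x * g1 x))) / h)"
  define w' where "w' = (\<lambda>x. (- l x * w x + (- h * a' x * v2 x + (g1 x - a x * g2 x))) / h)"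
  define e where "e = (\<lambda>x. u x * cnj (u x) - w x * cnj (w x))"
  define e' where "e' = (\<lambda>x. (u x * cnj (u' x) + u' x * cnj (u x)) - (w x * cnj (w' x) + w' x * cnj (w x)))"
  have v: "v1 \<in> AC_loc" "v2 \<in> AC_loc" using sol by (auto simp: first_order_solution_def)
  have uw: "u \<in> AC_loc" "w \<in> AC_loc"
    unfolding u_def w_def by (intro AC_loc_add AC_loc_diff AC_loc_mult a_AC b_AC v)+
  have e_AC: "e \<in> AC_loc"
    unfolding e_def by (intro AC_loc_diff AC_loc_mult AC_loc_cnj uw)
  have "AE x in lebesgue. (e has_vector_derivative e' x) (at x)"
    using sol[unfolded first_order_solution_def, THEN conjunct2, THEN conjunct2] a_der b_der
  proof eventually_elim
    case (elim x)
    then have "(u has_vector_derivative u' x) (at x)" "(w has_vector_derivative w' x) (at x)"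
      using transformed_derivative[of v1 x v2 g1 g2] by (simp_all add: u_def w_def u'_def w'_def)
    then show ?case unfolding e_def e'_def
      by (intro has_vector_derivative_diff has_vector_derivative_mult has_vector_derivative_cnj)
  qed
  from has_integral_linear[OF AC_loc_has_integral[OF e_AC this ts] bounded_linear_Re]
  have "((\<lambda>x. Re (e' x)) has_integral Re (e t) - Re (e s)) {s..t}" by (simp add: o_def)
  moreover have "Re (e x) = energy v1 v2 x" for x
  proof -
    have "e x = complex_of_real (energy v1 v2 x)"
      by (simp only: e_def energy_def u_def w_def of_real_diff complex_norm_square)
    then show ?thesis by simp
  qed
  ultimately have E: "((\<lambda>x. h * Re (e' x)) has_integral h * (energy v1 v2 t - energy v1 v2 s)) {s..t}"
    by (intro has_integral_mult_right) simp
  have V_cont: "continuous_on A V" for A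
    unfolding V_def by (intro continuous_intros AC_loc_continuous v)
  have G_int: "G integrable_on {s..t}"
    using integrable_on_lebesgue[OF g] by (auto simp: G_def intro: integrable_on_subinterval)
  have lower: "\<alpha> * V x - \<beta> * G x \<le> h * Re (e' x)" for x
  proof -
    have eq: "h * Re (z * cnj (d / h) + d / h * cnj z) = 2 * Re (cnj z * d)" for z d :: complex
      using h by (simp add: field_simps)
    have "h * Re (e' x) = 2 * Re (cnj (u x) * (l x * u x + (h * b' x * v1 x + (g2 x + b x * g1 x))))
        - 2 * Re (cnj (w x) * (- l x * w x + (- h * a' x * v2 x + (g1 x - a x * g2 x))))"
      unfolding e'_def u'_def w'_def minus_complex.simps right_diff_distrib eq ..
    then show ?thesis
      using energy_density_ge[where x=x and z="v1 x" and y="v2 x" and ?g1.0="g1 x" and ?g2.0="g2 x"]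
      by (simp only: u_def w_def V_def G_def)
  qed
  have "integral {s..t} (\<lambda>x. \<alpha> * V x - \<beta> * G x) \<le> h * (energy v1 v2 t - energy v1 v2 s)"
    unfolding integral_unique[OF E, symmetric]
    by (intro integral_le lower has_integral_integrable[OF E] integrable_diff integrable_on_mult_right
       G_int integrable_continuous_real V_cont)
  also have "integral {s..t} (\<lambda>x. \<alpha> * V x - \<beta> * G x) = \<alpha> * integral {s..t} V - \<beta> * integral {s..t} G"
    using Henstock_Kurzweil_Integration.integral_diff[of "\<lambda>x. \<alpha> * V x" "{s..t}" "\<lambda>x. \<beta> * G x"]
    by (simp add: integrable_on_mult_right G_int integrable_continuous_real V_cont)
  finally have 1: "\<alpha> * integral {s..t} V \<le> h * (energy v1 v2 t - energy v1 v2 s) + \<beta> * integral {s..t} G" by simp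
  have "integral {s..t} G \<le> integral UNIV G"
    using g G_int by (intro integral_subset_le integrable_on_lebesgue) (auto simp: G_def)
  then have "\<beta> * integral {s..t} G \<le> \<beta> * (LINT x|lebesgue. G x)"
    using \<beta>_nonneg g by (intro mult_left_mono) (auto simp: integral_lebesgue G_def)
  with 1 show ?thesis by (simp add: V_def G_def)
qed

text \<open>
  The energy inequality is applied on intervals whose end points are chosen far out and such that
  \<open>|v|\<^sup>2\<close>, and therefore the energy, is small there.
\<close>

theorem a_priori_bound:
  assumes sol: "first_order_solution h \<zeta> p q g1 g2 v1 v2"
    and g: "integrable lebesgue (\<lambda>x. (norm (g1 x))\<^sup>2 + (norm (g2 x))\<^sup>2)"
    and v: "integrable lebesgue (\<lambda>x. (norm (v1 x))\<^sup>2 + (norm (v2 x))\<^sup>2)"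
  shows "(LINT x|lebesgue. (norm (v1 x))\<^sup>2 + (norm (v2 x))\<^sup>2)
     \<le> \<beta> / \<alpha> * (LINT x|lebesgue. (norm (g1 x))\<^sup>2 + (norm (g2 x))\<^sup>2)"
proof -
  define V G where "V = (\<lambda>x. (norm (v1 x))\<^sup>2 + (norm (v2 x))\<^sup>2)" and "G = (\<lambda>x. (norm (g1 x))\<^sup>2 + (norm (g2 x))\<^sup>2)"
  have vAC: "v1 \<in> AC_loc" "v2 \<in> AC_loc" using sol by (auto simp: first_order_solution_def)
  have V_cont: "continuous_on A V" for A
    unfolding V_def by (intro continuous_intros AC_loc_continuous vAC)
  have V: "integrable lebesgue V" "integrable lebesgue (\<lambda>x. V (- x))" "\<And>x. 0 \<le> V x"
    using v integral_reflect_lebesgue[OF v] by (simp_all add: V_def)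
  have "\<alpha> * integral {- real n..real n} V \<le> \<beta> * (LINT x|lebesgue. G x)" for n
  proof (rule field_le_epsilon)
    fix e :: real assume "e > 0"
    \<comment> \<open>the energy is at most \<open>2(1 + K\<^sup>2)|v|\<^sup>2\<close>, so values \<open>|v|\<^sup>2 < e/C\<close> at both ends make the
      boundary terms at most \<open>e\<close>\<close>
    define C where "C = 4 * h * (1 + K\<^sup>2)"
    have "C > 0" using h by (auto simp: C_def add_pos_nonneg)
    then have eC: "e / C > 0" using \<open>e > 0\<close> by simp
    obtain t where t: "t \<ge> real n" "V t < e / C" using integrable_small_value[OF V(1,3) eC] by blast
    obtain s where s: "s \<ge> real n" "V (- s) < e / C"
      using integrable_small_value[OF V(2) _ eC] V(3) by blast
    have "integral {- real n..real n} V \<le> integral {- s..t} V"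
      using s t V by (intro integral_subset_le integrable_continuous_real V_cont) auto
    then have "\<alpha> * integral {- real n..real n} V \<le> \<alpha> * integral {- s..t} V"
      using \<alpha>_pos by (intro mult_left_mono) auto
    also have "\<dots> \<le> h * (energy v1 v2 t - energy v1 v2 (- s)) + \<beta> * (LINT x|lebesgue. G x)"
      using energy_inequality[OF sol g, of "- s" t] s t by (simp add: V_def G_def)
    also have "energy v1 v2 t - energy v1 v2 (- s) \<le> 2 * (1 + K\<^sup>2) * V t + 2 * (1 + K\<^sup>2) * V (- s)"
      using abs_energy_le[of v1 v2 t] abs_energy_le[of v1 v2 "- s"] by (simp add: V_def)
    also have "\<dots> \<le> 2 * (1 + K\<^sup>2) * (e / C) + 2 * (1 + K\<^sup>2) * (e / C)"
      using s t by (intro add_mono mult_left_mono) auto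
    also have "\<dots> = e / h"
    proof -
      obtain D where D: "1 + K\<^sup>2 = D" by simp
      have "D > 0" using D by (smt (verit) zero_le_power2)
      then show ?thesis using h unfolding C_def D by (simp add: field_simps)
    qed
    finally show "\<alpha> * integral {- real n..real n} V \<le> \<beta> * (LINT x|lebesgue. G x) + e"
      using h by (simp add: mult_left_mono)
  qed
  then have "integral {- real n..real n} V \<le> \<beta> / \<alpha> * (LINT x|lebesgue. G x)" for n
    using \<alpha>_pos by (simp add: field_simps)
  from integrable_if_bounded_on_intervals[OF V_cont V(3) this]
  show ?thesis by (simp add: V_def G_def)
qed


lemma \<kappa>_AC: "\<kappa> \<in> AC_loc"
proof (rule AC_loc_dominated[OF AC_loc_mult[OF a_AC b_AC], of _ "k * k"])
  fix x y
  have "\<kappa> x - \<kappa> y = \<kappa> x * (\<kappa> y * (1 + a y * b y)) - \<kappa> y * (\<kappa> x * (1 + a x * b x))"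
    by (simp add: \<kappa>_eq)
  also have "\<dots> = \<kappa> x * \<kappa> y * (a y * b y - a x * b x)" by (simp add: algebra_simps)
  finally have "norm (\<kappa> x - \<kappa> y) = norm (\<kappa> x) * norm (\<kappa> y) * norm (a x * b x - a y * b y)"
    by (simp add: norm_mult norm_minus_commute)
  also have "\<dots> \<le> k * k * norm (a x * b x - a y * b y)"
    using k \<kappa>_le by (intro mult_right_mono mult_mono) auto
  finally show "norm (\<kappa> x - \<kappa> y) \<le> k * k * norm (a x * b x - a y * b y)" .
qed

lemma \<kappa>_has_derivative:
  assumes "(a has_vector_derivative a' x) (at x)" "(b has_vector_derivative b' x) (at x)"
  shows "(\<kappa> has_vector_derivative - (\<kappa> x)\<^sup>2 * (a x * b' x + a' x * b x)) (at x)"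
proof -
  have ne: "1 + a y * b y \<noteq> 0" for y
    using \<kappa>_eq[of y] by auto
  have "\<kappa> y = inverse (1 + a y * b y)" for y
    using \<kappa>_eq[of y] by (intro inverse_unique[symmetric]) (simp only: mult.commute)
  then have \<kappa>: "\<kappa> = (\<lambda>y. inverse (1 + a y * b y))" by blast
  have "((\<lambda>y. 1 + a y * b y) has_vector_derivative a x * b' x + a' x * b x) (at x)"
    using has_vector_derivative_add[OF has_vector_derivative_const has_vector_derivative_mult[OF assms]] by simp
  from field_vector_diff_chain_at[OF this DERIV_inverse[OF ne]]
  show ?thesis by (simp add: o_def \<kappa> power2_eq_square mult.commute)
qed

text \<open>
  Rather than differentiating the formulas for \<open>v\<^sub>1\<close> and \<open>v\<^sub>2\<close>, one uses only that the derivatives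
  exist: differentiating \<open>u = v\<^sub>2 + b v\<^sub>1\<close> and \<open>w = v\<^sub>1 - a v\<^sub>2\<close> yields a linear system for them whose
  determinant \<open>1 + ab\<close> does not vanish, and the required values solve the same system.
\<close>

lemma back_transformed_solution:
  assumes uw: "u \<in> AC_loc" "w \<in> AC_loc"
    and v1: "v1 = (\<lambda>x. \<kappa> x * (w x + a x * u x))" and v2: "v2 = (\<lambda>x. \<kappa> x * (u x - b x * w x))"
    and u': "AE x in lebesgue. (u has_vector_derivative
       (l x * u x + (h * b' x * v1 x + (g2 x + b x * g1 x))) / h) (at x)"
    and w': "AE x in lebesgue. (w has_vector_derivative
       (- l x * w x + (- h * a' x * v2 x + (g1 x - a x * g2 x))) / h) (at x)"
  shows "first_order_solution h \<zeta> p q g1 g2 v1 v2"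
  unfolding first_order_solution_def
proof (intro conjI)
  show "v1 \<in> AC_loc" "v2 \<in> AC_loc"
    unfolding v1 v2 by (intro AC_loc_mult AC_loc_add AC_loc_diff \<kappa>_AC a_AC b_AC uw)+
  have u_eq: "v2 x + b x * v1 x = u x" and w_eq: "v1 x - a x * v2 x = w x" for x
    using transform_inverse_transform[of "v1 x" x "w x" "u x" "v2 x"] by (simp_all add: v1 v2)
  show "AE x in lebesgue.
        (v1 has_vector_derivative (- \<zeta> * v1 x + q x * v2 x + g1 x) / complex_of_real h) (at x) \<and>
        (v2 has_vector_derivative (p x * v1 x + \<zeta> * v2 x + g2 x) / complex_of_real h) (at x)"
    using u' w' a_der b_der
  proof eventually_elim
    case (elim x)
    have h0: "complex_of_real h \<noteq> 0" using h by simp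
    note \<kappa>' = \<kappa>_has_derivative[OF elim(3,4)]
    obtain d1 where d1: "(v1 has_vector_derivative d1) (at x)"
      unfolding v1 using has_vector_derivative_mult[OF \<kappa>' has_vector_derivative_add[OF elim(2)
          has_vector_derivative_mult[OF elim(3) elim(1)]]] by blast
    obtain d2 where d2: "(v2 has_vector_derivative d2) (at x)"
      unfolding v2 using has_vector_derivative_mult[OF \<kappa>' has_vector_derivative_diff[OF elim(1)
          has_vector_derivative_mult[OF elim(4) elim(2)]]] by blast
    define y1 where "y1 = (- \<zeta> * v1 x + q x * v2 x + g1 x) / h"
    define y2 where "y2 = (p x * v1 x + \<zeta> * v2 x + g2 x) / h"
    have "((\<lambda>x. v2 x + b x * v1 x) has_vector_derivative d2 + (b x * d1 + b' x * v1 x)) (at x)"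
      by (rule has_vector_derivative_add[OF d2 has_vector_derivative_mult[OF elim(4) d1]])
    then have "d2 + (b x * d1 + b' x * v1 x) = (l x * u x + (h * b' x * v1 x + (g2 x + b x * g1 x))) / h"
      unfolding u_eq by (rule vector_derivative_unique_at) (rule elim(1))
    then have 1: "d2 + b x * d1 = (l x * u x + (g2 x + b x * g1 x)) / h"
      using h0 by (simp add: field_simps)
    have "((\<lambda>x. v1 x - a x * v2 x) has_vector_derivative d1 - (a x * d2 + a' x * v2 x)) (at x)"
      by (rule has_vector_derivative_diff[OF d1 has_vector_derivative_mult[OF elim(3) d2]])
    then have "d1 - (a x * d2 + a' x * v2 x) = (- l x * w x + (- h * a' x * v2 x + (g1 x - a x * g2 x))) / h"
      unfolding w_eq by (rule vector_derivative_unique_at) (rule elim(2))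
    then have 2: "d1 - a x * d2 = (- l x * w x + (g1 x - a x * g2 x)) / h"
      using h0 by (simp add: field_simps)
    have 3: "y2 + b x * y1 = (l x * u x + (g2 x + b x * g1 x)) / h"
      unfolding y1_def y2_def u_eq[symmetric] diagonalize(1)[symmetric] using h0 by (simp add: field_simps)
    have 4: "y1 - a x * y2 = (- l x * w x + (g1 x - a x * g2 x)) / h"
      unfolding y1_def y2_def w_eq[symmetric] diagonalize(2)[symmetric] using h0 by (simp add: field_simps)
    have "d1 = y1" "d2 = y2"
      using inverse_transform_transform[OF 1[symmetric] 2[symmetric]] inverse_transform_transform[OF 3[symmetric] 4[symmetric]] by simp_all
    then show ?case using d1 d2 by (simp add: y1_def y2_def)
  qed
qed

text \<open>
  The fixed point is sought among bounded continuous pairs \<open>\<phi> = (u, w)\<close>, where the coupling costs a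
  factor \<open>hMk(1 + K)/c \<le> 1/8\<close> in each component. Square integrability follows afterwards: the fixed
  point has bounded energy, so the energy inequality bounds the integral of \<open>|v|\<^sup>2\<close> over every
  interval by the same constant.
\<close>

theorem solution_exists:
  assumes g_meas: "g1 \<in> borel_measurable lebesgue" "g2 \<in> borel_measurable lebesgue"
    and g: "integrable lebesgue (\<lambda>x. (norm (g1 x))\<^sup>2 + (norm (g2 x))\<^sup>2)"
  obtains v1 v2 where "first_order_solution h \<zeta> p q g1 g2 v1 v2"
    "integrable lebesgue (\<lambda>x. (norm (v1 x))\<^sup>2 + (norm (v2 x))\<^sup>2)"
proof -
  have h0: "complex_of_real h \<noteq> 0" using h by simp
  have "continuous_on UNIV (\<lambda>x. l x / h)" using h0 l_cont by (intro continuous_intros) auto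
  then obtain \<Lambda> where \<Lambda>: "\<And>x. (\<Lambda> has_vector_derivative l x / h) (at x)"
    using continuous_primitive by blast
  interpret G: growing_exponent \<Lambda> "\<lambda>x. l x / h" "c / h"
  proof
    show "continuous_on UNIV (\<lambda>x. l x / h)" by fact
    show "c / h \<le> Re (l x / h)" for x using l_ge[of x] h by (simp add: divide_right_mono)
  qed (use \<Lambda> c h in auto)
  define V1 where "V1 = (\<lambda>\<phi> x. \<kappa> x * (snd (apply_bcontfun \<phi> x) + a x * fst (apply_bcontfun \<phi> x)))"
  define V2 where "V2 = (\<lambda>\<phi> x. \<kappa> x * (fst (apply_bcontfun \<phi> x) - b x * snd (apply_bcontfun \<phi> x)))"
  define FU where "FU = (\<lambda>\<phi> x. b' x * V1 \<phi> x + (g2 x + b x * g1 x) / h)"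
  define FW where "FW = (\<lambda>\<phi> x. - a' x * V2 \<phi> x + (g1 x - a x * g2 x) / h)"
  define N where "N = M * (k * (1 + K))"
  have N0: "0 \<le> N" using M k K by (simp add: N_def)
  have comp: "norm (fst z) \<le> norm z" "norm (snd z) \<le> norm z" for z :: "complex \<times> complex"
    using norm_fst_le[of "fst z" "snd z"] norm_snd_le[of "snd z" "fst z"] by simp_all
  have V_le: "norm (V1 \<phi> x) \<le> k * (1 + K) * norm (apply_bcontfun \<phi> x)" "norm (V2 \<phi> x) \<le> k * (1 + K) * norm (apply_bcontfun \<phi> x)" for \<phi> x
    using norm_inverse_transform_le[of "fst (apply_bcontfun \<phi> x)" "norm (apply_bcontfun \<phi> x)" "snd (apply_bcontfun \<phi> x)" "norm (apply_bcontfun \<phi> x)" x] comp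
    by (auto simp: V1_def V2_def algebra_simps)
  have V_diff: "V1 \<phi> x - V1 \<psi> x = V1 (\<phi> - \<psi>) x" "V2 \<phi> x - V2 \<psi> x = V2 (\<phi> - \<psi>) x" for \<phi> \<psi> x
    by (simp_all add: V1_def V2_def algebra_simps)
  have coef: "norm (d * t) \<le> N * norm \<phi>" if "norm d \<le> M" "norm t \<le> k * (1 + K) * norm (apply_bcontfun \<phi> x)"
    for d t :: complex and \<phi> :: "real \<Rightarrow>\<^sub>C (complex \<times> complex)" and x
  proof -
    have "norm (d * t) \<le> M * (k * (1 + K) * norm (apply_bcontfun \<phi> x))"
      using that M by (simp add: norm_mult mult_mono)
    also have "\<dots> \<le> M * (k * (1 + K) * norm \<phi>)"
      using M k K norm_bounded[of \<phi> x] by (intro mult_left_mono) auto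
    finally show ?thesis by (simp add: N_def mult.assoc)
  qed
  have V_cont: "continuous_on UNIV (V1 \<phi>)" "continuous_on UNIV (V2 \<phi>)" for \<phi>
    unfolding V1_def V2_def
    by (intro continuous_intros AC_loc_continuous \<kappa>_AC a_AC b_AC continuous_on_apply_bcontfun)+
  note [measurable] = g_meas a'_meas b'_meas continuous_lebesgue_measurable[OF V_cont(1)]
    continuous_lebesgue_measurable[OF V_cont(2)]
    continuous_lebesgue_measurable[OF AC_loc_continuous[OF a_AC]]
    continuous_lebesgue_measurable[OF AC_loc_continuous[OF b_AC]]
  have le1: "t \<le> 1 + t\<^sup>2" for t :: real
    using zero_le_power2[of "t - 1/2"] by (simp add: power2_eq_square algebra_simps)
  have source_int: "integrable lebesgue (\<lambda>x. (norm (F x / complex_of_real h))\<^sup>2)"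
    if [measurable]: "F \<in> borel_measurable lebesgue"
      and "\<And>x. (norm (F x))\<^sup>2 \<le> 2 * (1 + K\<^sup>2) * ((norm (g1 x))\<^sup>2 + (norm (g2 x))\<^sup>2)" for F
  proof (rule Bochner_Integration.integrable_bound)
    show "integrable lebesgue (\<lambda>x. 2 * (1 + K\<^sup>2) / h\<^sup>2 * ((norm (g1 x))\<^sup>2 + (norm (g2 x))\<^sup>2))"
      using g by simp
    show "AE x in lebesgue. norm ((norm (F x / complex_of_real h))\<^sup>2)
       \<le> norm (2 * (1 + K\<^sup>2) / h\<^sup>2 * ((norm (g1 x))\<^sup>2 + (norm (g2 x))\<^sup>2))"
    proof (rule AE_I2)
      fix x
      show "norm ((norm (F x / complex_of_real h))\<^sup>2)
         \<le> norm (2 * (1 + K\<^sup>2) / h\<^sup>2 * ((norm (g1 x))\<^sup>2 + (norm (g2 x))\<^sup>2))"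
        using that(2)[of x] h by (simp add: norm_divide power_divide divide_right_mono abs_mult)
    qed
  qed measurable
  have sq: "(norm (g2 x + b x * g1 x))\<^sup>2 \<le> 2 * (1 + K\<^sup>2) * ((norm (g1 x))\<^sup>2 + (norm (g2 x))\<^sup>2)"
    "(norm (g1 x - a x * g2 x))\<^sup>2 \<le> 2 * (1 + K\<^sup>2) * ((norm (g1 x))\<^sup>2 + (norm (g2 x))\<^sup>2)" for x
    using norm_sq_uw_le[of "g2 x" x "g1 x"] by (smt (verit) zero_le_power2)+
  have admU: "admissible (FU \<phi>) (N * norm \<phi> + 1) (\<lambda>x. (norm ((g2 x + b x * g1 x) / h))\<^sup>2)" for \<phi>
    unfolding admissible_def
  proof (intro conjI allI)
    show "FU \<phi> \<in> borel_measurable lebesgue" unfolding FU_def by measurable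
    show "integrable lebesgue (\<lambda>x. (norm ((g2 x + b x * g1 x) / h))\<^sup>2)"
      by (intro source_int sq) measurable
    fix x
    show "norm (FU \<phi> x) \<le> N * norm \<phi> + 1 + (norm ((g2 x + b x * g1 x) / h))\<^sup>2"
      using norm_triangle_ineq[of "b' x * V1 \<phi> x" "(g2 x + b x * g1 x) / h"]
        coef[OF b'_le V_le(1), of x \<phi> x] le1[of "norm ((g2 x + b x * g1 x) / h)"]
      by (simp only: FU_def)
  qed (use N0 in auto)
  have admW: "admissible (FW \<phi>) (N * norm \<phi> + 1) (\<lambda>x. (norm ((g1 x - a x * g2 x) / h))\<^sup>2)" for \<phi>
    unfolding admissible_def
  proof (intro conjI allI)
    show "FW \<phi> \<in> borel_measurable lebesgue" unfolding FW_def by measurable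
    show "integrable lebesgue (\<lambda>x. (norm ((g1 x - a x * g2 x) / h))\<^sup>2)"
      by (intro source_int sq) measurable
    fix x
    have "norm (- a' x) \<le> M" using a'_le[of x] by simp
    from coef[OF this V_le(2)[of \<phi> x]]
    show "norm (FW \<phi> x) \<le> N * norm \<phi> + 1 + (norm ((g1 x - a x * g2 x) / h))\<^sup>2"
      using norm_triangle_ineq[of "- a' x * V2 \<phi> x" "(g1 x - a x * g2 x) / h"]
        le1[of "norm ((g1 x - a x * g2 x) / h)"]
      by (simp only: FW_def)
  qed (use N0 in auto)
  have adm_diff: "admissible (\<lambda>x. FU \<phi> x - FU \<psi> x) (N * norm (\<phi> - \<psi>)) (\<lambda>x. 0)"
    "admissible (\<lambda>x. FW \<phi> x - FW \<psi> x) (N * norm (\<phi> - \<psi>)) (\<lambda>x. 0)" for \<phi> \<psi>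
  proof -
    have "FU \<phi> x - FU \<psi> x = b' x * V1 (\<phi> - \<psi>) x" "FW \<phi> x - FW \<psi> x = - a' x * V2 (\<phi> - \<psi>) x" for x
      by (simp_all add: FU_def FW_def V_diff[symmetric] algebra_simps)
    then show "admissible (\<lambda>x. FU \<phi> x - FU \<psi> x) (N * norm (\<phi> - \<psi>)) (\<lambda>x. 0)"
      "admissible (\<lambda>x. FW \<phi> x - FW \<psi> x) (N * norm (\<phi> - \<psi>)) (\<lambda>x. 0)"
      using coef[OF b'_le V_le(1)] coef[OF _ V_le(2), of "- a' _"] a'_le N0
      by (auto simp: admissible_def)
  qed
  define T where "T = (\<lambda>\<phi> x. (green \<Lambda> (FU \<phi>) x, green_stable \<Lambda> (FW \<phi>) x))"
  have T_mem: "T \<phi> \<in> bcontfun" for \<phi>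
  proof (rule bcontfun_normI)
    show "continuous_on UNIV (T \<phi>)" unfolding T_def
      by (intro continuous_intros AC_loc_continuous G.green_AC_loc[OF admU] G.green_stable_AC_loc[OF admW])
    show "norm (T \<phi> x) \<le> ((N * norm \<phi> + 1) / (c / h) + (LINT x|lebesgue. (norm ((g2 x + b x * g1 x) / h))\<^sup>2))
       + ((N * norm \<phi> + 1) / (c / h) + (LINT x|lebesgue. (norm ((g1 x - a x * g2 x) / h))\<^sup>2))" for x
      unfolding T_def
      by (rule order_trans[OF norm_Pair_le add_mono[OF G.norm_green_le[OF admU] G.norm_green_stable_le[OF admW]]])
  qed
  have contraction: "dist (Bcontfun (T \<phi>)) (Bcontfun (T \<psi>)) \<le> 1 / 4 * dist \<phi> \<psi>" for \<phi> \<psi>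
  proof (rule dist_bound)
    fix x
    have "norm (T \<phi> x - T \<psi> x) \<le> norm (green \<Lambda> (FU \<phi>) x - green \<Lambda> (FU \<psi>) x)
        + norm (green_stable \<Lambda> (FW \<phi>) x - green_stable \<Lambda> (FW \<psi>) x)"
      by (simp add: T_def norm_Pair_le)
    also have "\<dots> \<le> N * norm (\<phi> - \<psi>) / (c / h) + N * norm (\<phi> - \<psi>) / (c / h)"
      unfolding G.green_diff[OF admU admU] G.green_stable_diff[OF admW admW]
      using G.norm_green_le[OF adm_diff(1)] G.norm_green_stable_le[OF adm_diff(2)]
      by (intro add_mono) auto
    also have "\<dots> \<le> 1 / 4 * norm (\<phi> - \<psi>)"
    proof -
      have "8 * (h * N) \<le> c" using small by (simp add: N_def mult.assoc)
      from mult_right_mono[OF this, of "norm (\<phi> - \<psi>)"] show ?thesis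
        using c h by (simp add: field_simps)
    qed
    finally show "dist (apply_bcontfun (Bcontfun (T \<phi>)) x) (apply_bcontfun (Bcontfun (T \<psi>)) x) \<le> 1 / 4 * dist \<phi> \<psi>"
      by (simp add: Bcontfun_inverse T_mem dist_norm)
  qed
  obtain \<phi> where "Bcontfun (T \<phi>) = \<phi>"
    using banach_fix_type[of "1/4" "\<lambda>\<phi>. Bcontfun (T \<phi>)"] contraction by auto
  then have fixed_pt: "T \<phi> x = apply_bcontfun \<phi> x" for x by (metis Bcontfun_inverse T_mem)
  define u w where "u = green \<Lambda> (FU \<phi>)" and "w = green_stable \<Lambda> (FW \<phi>)"
  have uw: "fst (apply_bcontfun \<phi> x) = u x" "snd (apply_bcontfun \<phi> x) = w x" for x
    using fixed_pt[of x] by (auto simp: T_def u_def w_def prod_eq_iff)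
  have V: "V1 \<phi> = (\<lambda>x. \<kappa> x * (w x + a x * u x))" "V2 \<phi> = (\<lambda>x. \<kappa> x * (u x - b x * w x))"
    by (simp_all add: V1_def V2_def uw)
  have sol: "first_order_solution h \<zeta> p q g1 g2 (V1 \<phi>) (V2 \<phi>)"
  proof (rule back_transformed_solution[OF _ _ V])
    show "u \<in> AC_loc" "w \<in> AC_loc"
      unfolding u_def w_def by (rule G.green_AC_loc[OF admU] G.green_stable_AC_loc[OF admW])+
    show "AE x in lebesgue. (u has_vector_derivative
       (l x * u x + (h * b' x * V1 \<phi> x + (g2 x + b x * g1 x))) / h) (at x)"
      using G.green_has_derivative[OF admU, of \<phi>] unfolding u_def[symmetric] unfolding FU_def
      by eventually_elim (use h0 in \<open>simp add: add_divide_distrib\<close>)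
    show "AE x in lebesgue. (w has_vector_derivative
       (- l x * w x + (- h * a' x * V2 \<phi> x + (g1 x - a x * g2 x))) / h) (at x)"
      using G.green_stable_has_derivative[OF admW, of \<phi>] unfolding w_def[symmetric] unfolding FW_def
      by eventually_elim (use h0 in \<open>simp add: add_divide_distrib diff_divide_distrib\<close>)
  qed
  have E: "\<bar>energy (V1 \<phi>) (V2 \<phi>) x\<bar> \<le> (norm \<phi>)\<^sup>2" for x
  proof -
    have "energy (V1 \<phi>) (V2 \<phi>) x = (norm (fst (apply_bcontfun \<phi> x)))\<^sup>2 - (norm (snd (apply_bcontfun \<phi> x)))\<^sup>2"
      using transform_inverse_transform[of "V1 \<phi> x" x "snd (apply_bcontfun \<phi> x)" "fst (apply_bcontfun \<phi> x)" "V2 \<phi> x"]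
      by (simp add: energy_def V1_def V2_def)
    moreover have "(norm (fst (apply_bcontfun \<phi> x)))\<^sup>2 \<le> (norm \<phi>)\<^sup>2" "(norm (snd (apply_bcontfun \<phi> x)))\<^sup>2 \<le> (norm \<phi>)\<^sup>2"
      by (rule power_mono[OF order_trans[OF comp(1) norm_bounded] norm_ge_zero]
          power_mono[OF order_trans[OF comp(2) norm_bounded] norm_ge_zero])+
    ultimately show ?thesis
      using zero_le_power2[of "norm (fst (apply_bcontfun \<phi> x))"]
        zero_le_power2[of "norm (snd (apply_bcontfun \<phi> x))"] by linarith
  qed
  define R where "R = (h * (2 * (norm \<phi>)\<^sup>2) + \<beta> * (LINT x|lebesgue. (norm (g1 x))\<^sup>2 + (norm (g2 x))\<^sup>2)) / \<alpha>"
  have "integral {- real n..real n} (\<lambda>x. (norm (V1 \<phi> x))\<^sup>2 + (norm (V2 \<phi> x))\<^sup>2) \<le> R" for n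
  proof -
    have "energy (V1 \<phi>) (V2 \<phi>) (real n) - energy (V1 \<phi>) (V2 \<phi>) (- real n) \<le> 2 * (norm \<phi>)\<^sup>2"
      using E[of "real n"] E[of "- real n"] by simp
    then have "\<alpha> * integral {- real n..real n} (\<lambda>x. (norm (V1 \<phi> x))\<^sup>2 + (norm (V2 \<phi> x))\<^sup>2)
      \<le> h * (2 * (norm \<phi>)\<^sup>2) + \<beta> * (LINT x|lebesgue. (norm (g1 x))\<^sup>2 + (norm (g2 x))\<^sup>2)"
      using energy_inequality[OF sol g, of "- real n" "real n"] h
      by (smt (verit) mult_left_mono of_nat_0_le_iff)
    then show ?thesis using \<alpha>_pos by (simp add: R_def pos_le_divide_eq mult.commute)
  qed
  then have "integrable lebesgue (\<lambda>x. (norm (V1 \<phi> x))\<^sup>2 + (norm (V2 \<phi> x))\<^sup>2)"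
    by (intro conjunct1[OF integrable_if_bounded_on_intervals[where R=R]] continuous_intros V_cont) auto
  with sol show thesis by (rule that)
qed

end

section \<open>The threshold for the semiclassical parameter\<close>

definition square_integrable :: "(real \<Rightarrow> complex) \<Rightarrow> (real \<Rightarrow> complex) \<Rightarrow> bool" where
  "square_integrable u w \<longleftrightarrow> integrable lebesgue (\<lambda>x. (norm (u x))\<^sup>2 + (norm (w x))\<^sup>2)"

definition square_integral :: "(real \<Rightarrow> complex) \<Rightarrow> (real \<Rightarrow> complex) \<Rightarrow> real" where
  "square_integral u w = (LINT x|lebesgue. (norm (u x))\<^sup>2 + (norm (w x))\<^sup>2)"

text \<open>
  The resolvent conditions, expressed for the first-order system. Uniqueness is contained in the
  estimate, by linearity.
\<close>

definition well_posed :: "real \<Rightarrow> complex \<Rightarrow> (real \<Rightarrow> complex) \<Rightarrow> (real \<Rightarrow> complex) \<Rightarrow> bool" where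
  "well_posed h \<zeta> p q \<longleftrightarrow>
    (\<exists>C. \<forall>g1 g2 v1 v2. first_order_solution h \<zeta> p q g1 g2 v1 v2 \<longrightarrow>
       square_integrable g1 g2 \<longrightarrow> square_integrable v1 v2 \<longrightarrow>
       square_integral v1 v2 \<le> C * square_integral g1 g2) \<and>
    (\<forall>g1 g2. g1 \<in> borel_measurable lebesgue \<longrightarrow> g2 \<in> borel_measurable lebesgue \<longrightarrow>
       square_integrable g1 g2 \<longrightarrow>
       (\<exists>v1 v2. first_order_solution h \<zeta> p q g1 g2 v1 v2 \<and> square_integrable v1 v2))"

lemma (in diagonalized_system) well_posed: "well_posed h \<zeta> p q"
  unfolding well_posed_def
proof (intro conjI exI[of _ "\<beta> / \<alpha>"] allI impI)
  fix g1 g2 v1 v2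
  assume "first_order_solution h \<zeta> p q g1 g2 v1 v2" "square_integrable g1 g2" "square_integrable v1 v2"
  then show "square_integral v1 v2 \<le> \<beta> / \<alpha> * square_integral g1 g2"
    unfolding square_integrable_def square_integral_def by (rule a_priori_bound)
next
  fix g1 g2 :: "real \<Rightarrow> complex"
  assume g: "g1 \<in> borel_measurable lebesgue" "g2 \<in> borel_measurable lebesgue" "square_integrable g1 g2"
  obtain v1 v2 where "first_order_solution h \<zeta> p q g1 g2 v1 v2"
    "integrable lebesgue (\<lambda>x. (norm (v1 x))\<^sup>2 + (norm (v2 x))\<^sup>2)"
    by (rule solution_exists[OF g(1,2) g(3)[unfolded square_integrable_def]])
  then show "\<exists>v1 v2. first_order_solution h \<zeta> p q g1 g2 v1 v2 \<and> square_integrable v1 v2"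
    unfolding square_integrable_def by blast
qed

lemma first_order_solution_swap:
  "first_order_solution h (- \<zeta>) q p g2 g1 v2 v1 \<longleftrightarrow> first_order_solution h \<zeta> p q g1 g2 v1 v2"
proof -
  have "- \<zeta> * a + b * c + d = b * c + - \<zeta> * a + d" for a b c d :: complex by simp
  then show ?thesis unfolding first_order_solution_def by (simp only: minus_minus conj_ac add.commute)
qed

lemma well_posed_swap:
  assumes "well_posed h (- \<zeta>) q p" shows "well_posed h \<zeta> p q"
proof -
  have comm: "square_integrable w u = square_integrable u w" "square_integral w u = square_integral u w" for u w
    by (simp_all add: square_integrable_def square_integral_def add.commute)
  obtain C where C: "\<And>g1 g2 v1 v2. first_order_solution h (- \<zeta>) q p g1 g2 v1 v2 \<Longrightarrow>
       square_integrable g1 g2 \<Longrightarrow> square_integrable v1 v2 \<Longrightarrow> square_integral v1 v2 \<le> C * square_integral g1 g2"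
    using assms unfolding well_posed_def by blast
  have ex: "\<exists>v1 v2. first_order_solution h (- \<zeta>) q p g1 g2 v1 v2 \<and> square_integrable v1 v2"
    if "g1 \<in> borel_measurable lebesgue" "g2 \<in> borel_measurable lebesgue" "square_integrable g1 g2" for g1 g2
    using assms that unfolding well_posed_def by blast
  show ?thesis
    unfolding well_posed_def
  proof (intro conjI exI[of _ C] allI impI)
    fix g1 g2 v1 v2
    assume "first_order_solution h \<zeta> p q g1 g2 v1 v2" "square_integrable g1 g2" "square_integrable v1 v2"
    then show "square_integral v1 v2 \<le> C * square_integral g1 g2"
      using C[of g2 g1 v2 v1] by (simp add: first_order_solution_swap comm)
  next
    fix g1 g2 :: "real \<Rightarrow> complex"
    assume "g1 \<in> borel_measurable lebesgue" "g2 \<in> borel_measurable lebesgue" "square_integrable g1 g2"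
    then obtain v2 v1 where "first_order_solution h (- \<zeta>) q p g2 g1 v2 v1" "square_integrable v2 v1"
      using ex[of g2 g1] by (auto simp: comm)
    then show "\<exists>v1 v2. first_order_solution h \<zeta> p q g1 g2 v1 v2 \<and> square_integrable v1 v2"
      by (auto simp: first_order_solution_swap comm)
  qed
qed

text \<open>
  With \<open>A = (Re l)\<^sup>2\<close> and \<open>\<zeta> = y + i x\<close>, eliminating \<open>Im l\<close> from the real and imaginary parts of
  \<open>l\<^sup>2 = r + \<zeta>\<^sup>2\<close> gives \<open>(A - y\<^sup>2)(A + x\<^sup>2) = r A \<ge> - m A\<close>. If \<open>x\<close> is not small, then
  \<open>A + x\<^sup>2 \<ge> \<delta>\<^sup>2/4\<close> turns this into a lower bound for \<open>A\<close>; otherwise \<open>y\<^sup>2 \<ge> m + \<delta>\<^sup>2/4\<close>, and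
  \<open>A \<le> A + x\<^sup>2\<close> gives \<open>A \<ge> y\<^sup>2 - m\<close>.
\<close>

lemma Re_sqrt_lower_bound:
  fixes l \<zeta> :: complex and r m \<delta> :: real
  assumes l: "l\<^sup>2 = of_real r + \<zeta>\<^sup>2" and r: "\<bar>r\<bar> \<le> m" and \<delta>: "0 < \<delta>" "\<delta> \<le> Re \<zeta>"
    and \<zeta>: "\<delta> / 2 \<le> \<bar>Im \<zeta>\<bar> \<or> sqrt m + \<delta> / 2 \<le> Re \<zeta>"
  shows "min (\<delta>\<^sup>2 / 4) (\<delta>\<^sup>2 * \<delta>\<^sup>2 / (\<delta>\<^sup>2 + 4 * m)) \<le> (Re l)\<^sup>2"
proof -
  define A x y where "A = (Re l)\<^sup>2" and "x = Im \<zeta>" and "y = Re \<zeta>"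
  have m: "0 \<le> m" using r by simp
  have y: "\<delta>\<^sup>2 \<le> y\<^sup>2" "y > 0" using \<delta> by (auto simp: y_def intro: power_mono)
  have re: "A - (Im l)\<^sup>2 = r + y\<^sup>2 - x\<^sup>2" and im: "Re l * Im l = y * x"
    using arg_cong[OF l, of Re] arg_cong[OF l, of Im]
    by (simp_all add: A_def x_def y_def power2_eq_square mult.commute)
  have im2: "A * (Im l)\<^sup>2 = y\<^sup>2 * x\<^sup>2"
    using im unfolding A_def by (metis power_mult_distrib)
  have key: "(A - y\<^sup>2) * (A + x\<^sup>2) = r * A"
  proof -
    have "(A - y\<^sup>2) * (A + x\<^sup>2) = A * A + A * x\<^sup>2 - A * y\<^sup>2 - y\<^sup>2 * x\<^sup>2" by (simp add: algebra_simps)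
    also have "\<dots> = A * (A - (Im l)\<^sup>2 + x\<^sup>2 - y\<^sup>2)" using im2 by (simp add: algebra_simps)
    finally show ?thesis using re by (simp add: mult.commute)
  qed
  have A0: "0 \<le> A" by (simp add: A_def)
  have "- (m * A) \<le> r * A" using mult_right_mono[of "- m" r A] r A0 by simp
  then have key': "(y\<^sup>2 - A) * (A + x\<^sup>2) \<le> m * A" using key by (simp add: algebra_simps)
  from \<zeta> show ?thesis
  proof
    assume "\<delta> / 2 \<le> \<bar>Im \<zeta>\<bar>"
    then have x: "\<delta>\<^sup>2 / 4 \<le> x\<^sup>2"
      using power_mono[of "\<delta> / 2" "\<bar>x\<bar>" 2] \<delta> by (simp add: x_def power_divide)
    have d4: "0 < \<delta>\<^sup>2 + 4 * m" using \<delta> m by (simp add: add_pos_nonneg)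
    have "\<delta>\<^sup>2 * \<delta>\<^sup>2 \<le> A * (\<delta>\<^sup>2 + 4 * m)"
    proof (cases "y\<^sup>2 \<le> A")
      case True
      then have "\<delta>\<^sup>2 * \<delta>\<^sup>2 \<le> A * \<delta>\<^sup>2" using y by (intro mult_right_mono) auto
      also have "\<dots> \<le> A * (\<delta>\<^sup>2 + 4 * m)" using A0 m by (intro mult_left_mono) auto
      finally show ?thesis .
    next
      case False
      then have "(y\<^sup>2 - A) * (\<delta>\<^sup>2 / 4) \<le> (y\<^sup>2 - A) * (A + x\<^sup>2)"
        using x A0 by (intro mult_left_mono) auto
      also note key'
      finally have "y\<^sup>2 * \<delta>\<^sup>2 \<le> A * (\<delta>\<^sup>2 + 4 * m)" by (simp add: algebra_simps)
      moreover have "\<delta>\<^sup>2 * \<delta>\<^sup>2 \<le> y\<^sup>2 * \<delta>\<^sup>2" using y by (intro mult_right_mono) auto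
      ultimately show ?thesis by linarith
    qed
    then show ?thesis using d4 by (simp add: A_def[symmetric] min_le_iff_disj pos_divide_le_eq)
  next
    assume "sqrt m + \<delta> / 2 \<le> Re \<zeta>"
    then have "(sqrt m + \<delta> / 2)\<^sup>2 \<le> y\<^sup>2" using m \<delta> unfolding y_def by (intro power_mono) auto
    moreover have "m + \<delta>\<^sup>2 / 4 \<le> (sqrt m + \<delta> / 2)\<^sup>2"
      using m \<delta> by (simp add: power2_sum power_divide)
    ultimately have y2: "m + \<delta>\<^sup>2 / 4 \<le> y\<^sup>2" by linarith
    have "A + x\<^sup>2 \<noteq> 0"
    proof
      assume "A + x\<^sup>2 = 0"
      then have "A = 0" "x\<^sup>2 = 0" using A0 by (smt (verit) zero_le_power2)+
      with re have "- (Im l)\<^sup>2 = r + y\<^sup>2" by simp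
      moreover have "r + y\<^sup>2 > 0" using y2 r zero_less_power[OF \<delta>(1), of 2] by linarith
      ultimately show False by (smt (verit) zero_le_power2)
    qed
    then have pos: "0 < A + x\<^sup>2" using A0 by (smt (verit) zero_le_power2)
    have "(y\<^sup>2 - A) * (A + x\<^sup>2) \<le> m * (A + x\<^sup>2)"
      using key' mult_left_mono[of A "A + x\<^sup>2" m] m by simp
    then have "y\<^sup>2 - A \<le> m" using pos by simp
    then show ?thesis using y2 by (simp add: A_def[symmetric] min_le_iff_disj)
  qed
qed

lemma not_nonpos_Reals_if_Re_csqrt_pos:
  assumes "0 < Re (csqrt z)" shows "z \<notin> \<real>\<^sub>\<le>\<^sub>0"
proof
  assume "z \<in> \<real>\<^sub>\<le>\<^sub>0"
  then obtain t where "z = of_real t" "t \<le> 0" by (auto elim: nonpos_Reals_cases)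
  then show False using assms by (simp add: csqrt_of_real_nonpos)
qed

text \<open>
  Here \<open>a = q/\<mu>\<close> and \<open>b = p/\<mu>\<close> with \<open>\<mu> = l + \<zeta>\<close>, where \<open>Re \<zeta> > 0\<close> keeps \<open>\<mu>\<close> away from \<open>0\<close>. The
  constants depend on \<open>\<zeta>\<close> only through \<open>\<delta>\<close>, so one threshold serves all \<open>\<zeta>\<close>, large ones included.
\<close>

lemma exists_semiclassical_threshold:
  fixes p q p' q' :: "real \<Rightarrow> complex"
  assumes p: "p \<in> AC_loc" and q: "q \<in> AC_loc"
    and p_der: "AE x in lebesgue. (p has_vector_derivative p' x) (at x)"
    and q_der: "AE x in lebesgue. (q has_vector_derivative q' x) (at x)"
    and p'_meas: "p' \<in> borel_measurable lebesgue" and q'_meas: "q' \<in> borel_measurable lebesgue"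
    and p'_le: "\<And>x. norm (p' x) \<le> B" and q'_le: "\<And>x. norm (q' x) \<le> B"
    and p_le: "\<And>x. norm (p x) \<le> K0" and q_le: "\<And>x. norm (q x) \<le> K0"
    and pq_real: "\<And>x. p x * q x \<in> \<real>" and pq_le: "\<And>x. norm (p x * q x) \<le> m" and \<delta>: "0 < \<delta>"
  shows "\<exists>h\<^sub>o>0. \<forall>h \<zeta>. 0 < h \<longrightarrow> h < h\<^sub>o \<longrightarrow> \<delta> \<le> Re \<zeta> \<longrightarrow>
      \<delta> / 2 \<le> \<bar>Im \<zeta>\<bar> \<or> sqrt m + \<delta> / 2 \<le> Re \<zeta> \<longrightarrow> well_posed h \<zeta> p q"
proof -
  have K0: "0 \<le> K0" using p_le[of 0] norm_ge_zero order_trans by blast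
  have B: "0 \<le> B" using p'_le[of 0] norm_ge_zero order_trans by blast
  have m: "0 \<le> m" using pq_le[of 0] norm_ge_zero order_trans by blast
  define c where "c = sqrt (min (\<delta>\<^sup>2 / 4) (\<delta>\<^sup>2 * \<delta>\<^sup>2 / (\<delta>\<^sup>2 + 4 * m)))"
  have c: "0 < c" using \<delta> m by (simp add: c_def add_pos_nonneg)
  define K where "K = K0 / \<delta>"
  define k where "k = 1 + K0 * K0 / (2 * c * \<delta>)"
  define L where "L = K0 * B / c"
  define M where "M = B / \<delta> + K0 * L / \<delta>\<^sup>2"
  have nn: "0 \<le> K" "0 < k" "0 \<le> L" "0 \<le> M"
    using K0 B c \<delta> by (auto simp: K_def k_def L_def M_def add_pos_nonneg)
  define h0 where "h0 = c / (8 * (M * k * (1 + K)) + 1)"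
  have D: "0 < 8 * (M * k * (1 + K)) + 1" using nn by (simp add: add_nonneg_pos)
  have "well_posed h \<zeta> p q" if h: "0 < h" "h < h0" and \<zeta>: "\<delta> \<le> Re \<zeta>"
    "\<delta> / 2 \<le> \<bar>Im \<zeta>\<bar> \<or> sqrt m + \<delta> / 2 \<le> Re \<zeta>" for h \<zeta>
  proof -
    define l where "l = (\<lambda>x. csqrt (p x * q x + \<zeta>\<^sup>2))"
    define \<mu> where "\<mu> = (\<lambda>x. l x + \<zeta>)"
    have l2: "(l x)\<^sup>2 = p x * q x + \<zeta>\<^sup>2" for x by (simp add: l_def)
    have l_ge: "c \<le> Re (l x)" for x
    proof -
      obtain r where r: "p x * q x = complex_of_real r" using pq_real[of x] by (auto elim: Reals_cases)
      have "c\<^sup>2 \<le> (Re (l x))\<^sup>2"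
        using Re_sqrt_lower_bound[of "l x" r \<zeta> m \<delta>] l2[of x] pq_le[of x] \<delta> \<zeta> m
        unfolding c_def r by simp
      moreover have "0 \<le> Re (l x)" using csqrt_principal[of "p x * q x + \<zeta>\<^sup>2"] by (auto simp: l_def)
      ultimately show ?thesis using power2_le_imp_le by blast
    qed
    have l_norm: "c \<le> norm (l x)" for x using l_ge[of x] complex_Re_le_cmod order_trans by blast
    have \<mu>_Re: "\<delta> \<le> Re (\<mu> x)" for x using l_ge[of x] c \<zeta>(1) by (simp add: \<mu>_def)
    have \<mu>_norm: "\<delta> \<le> norm (\<mu> x)" for x using \<mu>_Re[of x] complex_Re_le_cmod order_trans by blast
    have l0: "l x \<noteq> 0" for x using l_norm[of x] c by auto
    have \<mu>0: "\<mu> x \<noteq> 0" for x using \<mu>_norm[of x] \<delta> by auto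
    have prod: "p x * q x = (l x - \<zeta>) * \<mu> x" for x
      using l2[of x] by (simp add: \<mu>_def power2_eq_square algebra_simps)
    have l_AC: "l \<in> AC_loc"
    proof (rule AC_loc_dominated[OF AC_loc_mult[OF p q], of _ "1 / (2 * c)"])
      fix x y
      have "2 * c \<le> Re (l x + l y)" using l_ge[of x] l_ge[of y] by simp
      then have s: "2 * c \<le> norm (l x + l y)" using complex_Re_le_cmod order_trans by blast
      have "p x * q x - p y * q y = (l x)\<^sup>2 - (l y)\<^sup>2" by (simp add: l2)
      also have "\<dots> = (l x - l y) * (l x + l y)" by (simp add: power2_eq_square algebra_simps)
      finally have "norm (p x * q x - p y * q y) = norm (l x - l y) * norm (l x + l y)" by (simp add: norm_mult)
      moreover have "norm (l x - l y) * (2 * c) \<le> norm (l x - l y) * norm (l x + l y)"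
        using s by (intro mult_left_mono) auto
      ultimately show "norm (l x - l y) \<le> 1 / (2 * c) * norm (p x * q x - p y * q y)"
        using c by (simp add: field_simps)
    qed
    have \<mu>_AC: "(\<lambda>x. inverse (\<mu> x)) \<in> AC_loc"
    proof (rule AC_loc_dominated[OF l_AC, of _ "1 / \<delta>\<^sup>2"])
      fix x y
      have "inverse (\<mu> x) - inverse (\<mu> y) = - (l x - l y) / (\<mu> x * \<mu> y)"
        using \<mu>0[of x] \<mu>0[of y] by (simp add: \<mu>_def field_simps)
      then have "norm (inverse (\<mu> x) - inverse (\<mu> y)) = norm (l x - l y) / (norm (\<mu> x) * norm (\<mu> y))"
        by (simp add: norm_divide norm_mult norm_minus_commute)
      also have "\<dots> \<le> norm (l x - l y) / (\<delta> * \<delta>)"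
        using \<delta> \<mu>_norm by (intro divide_left_mono mult_mono mult_pos_pos) (auto simp: \<mu>0)
      finally show "norm (inverse (\<mu> x) - inverse (\<mu> y)) \<le> 1 / \<delta>\<^sup>2 * norm (l x - l y)"
        by (simp add: power2_eq_square)
    qed
    define l' where "l' = (\<lambda>x. (p x * q' x + p' x * q x) * inverse (2 * l x))"
    have l'_le: "norm (l' x) \<le> L" for x
    proof -
      have "norm (p x * q' x + p' x * q x) \<le> K0 * B + B * K0"
        using p_le q_le p'_le q'_le K0 B
        by (intro order_trans[OF norm_triangle_ineq] add_mono) (simp_all add: norm_mult mult_mono)
      then have "norm (l' x) \<le> (K0 * B + B * K0) * inverse (2 * c)"
        unfolding l'_def norm_mult norm_inverse using l_norm[of x] c K0 B
        by (intro mult_mono le_imp_inverse_le) (auto simp: norm_mult)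
      then show ?thesis using c by (simp add: L_def field_simps)
    qed
    have l_der: "(l has_vector_derivative l' x) (at x)"
      if "(p has_vector_derivative p' x) (at x)" "(q has_vector_derivative q' x) (at x)" for x
    proof -
      have base: "((\<lambda>x. p x * q x + \<zeta>\<^sup>2) has_vector_derivative p x * q' x + p' x * q x) (at x)"
        using has_vector_derivative_add[OF has_vector_derivative_mult[OF that] has_vector_derivative_const] by simp
      have root: "(csqrt has_field_derivative inverse (2 * l x)) (at (p x * q x + \<zeta>\<^sup>2))"
        using less_le_trans[OF c l_ge[of x]] unfolding l_def
        by (intro has_field_derivative_csqrt not_nonpos_Reals_if_Re_csqrt_pos)
      from field_vector_diff_chain_at[OF base root] show ?thesis
        by (simp add: l_def l'_def o_def)
    qed
    \<comment> \<open>the quotients \<open>p / \<mu>\<close> and \<open>q / \<mu>\<close> are treated alike\<close>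
    define Q where "Q = (\<lambda>f x. f x * inverse (\<mu> x))"
    define Q' where "Q' = (\<lambda>f f' x. f x * (- l' x * (inverse (\<mu> x))\<^sup>2) + f' x * inverse (\<mu> x))"
    have Q_AC: "Q f \<in> AC_loc" if "f \<in> AC_loc" for f
      unfolding Q_def by (rule AC_loc_mult[OF that \<mu>_AC])
    have \<mu>_inv: "norm (inverse (\<mu> x)) \<le> 1 / \<delta>" for x
      using \<mu>_norm[of x] \<delta> by (simp add: norm_inverse inverse_eq_divide norm_divide frac_le)
    have Q_le: "norm (Q f x) \<le> K" if "norm (f x) \<le> K0" for f x
      using mult_mono[OF that \<mu>_inv[of x]] K0 by (simp add: Q_def K_def norm_mult)
    have Q'_le: "norm (Q' f f' x) \<le> M" if "norm (f x) \<le> K0" "norm (f' x) \<le> B" for f f' x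
    proof -
      have "norm (- l' x * (inverse (\<mu> x))\<^sup>2) \<le> L * (1 / \<delta>)\<^sup>2"
        unfolding norm_mult norm_power using l'_le[of x] \<mu>_inv[of x] nn
        by (intro mult_mono power_mono) auto
      then have "norm (f x * (- l' x * (inverse (\<mu> x))\<^sup>2)) \<le> K0 * (L * (1 / \<delta>)\<^sup>2)"
        using that K0 by (subst norm_mult, intro mult_mono) auto
      moreover have "norm (f' x * inverse (\<mu> x)) \<le> B * (1 / \<delta>)"
        using that \<mu>_inv[of x] B by (subst norm_mult, intro mult_mono) auto
      ultimately show ?thesis
        unfolding Q'_def M_def by (intro order_trans[OF norm_triangle_ineq]) (simp add: power_divide)
    qed
    have Q_der: "(Q f has_vector_derivative Q' f f' x) (at x)"
      if "(f has_vector_derivative f' x) (at x)" "(p has_vector_derivative p' x) (at x)"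
        "(q has_vector_derivative q' x) (at x)" for f f' x
    proof -
      have "(\<mu> has_vector_derivative l' x) (at x)"
        unfolding \<mu>_def using has_vector_derivative_add[OF l_der[OF that(2,3)] has_vector_derivative_const] by simp
      from field_vector_diff_chain_at[OF this DERIV_inverse[OF \<mu>0]]
      have "((\<lambda>x. inverse (\<mu> x)) has_vector_derivative - l' x * (inverse (\<mu> x))\<^sup>2) (at x)"
        by (simp add: o_def power2_eq_square mult.assoc)
      from has_vector_derivative_mult[OF that(1) this] show ?thesis by (simp only: Q_def Q'_def)
    qed
    note [measurable] = p'_meas q'_meas
      p[THEN AC_loc_continuous[where A=UNIV], THEN continuous_lebesgue_measurable]
      q[THEN AC_loc_continuous[where A=UNIV], THEN continuous_lebesgue_measurable]
      l_AC[THEN AC_loc_continuous[where A=UNIV], THEN continuous_lebesgue_measurable]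
      \<mu>_AC[THEN AC_loc_continuous[where A=UNIV], THEN continuous_lebesgue_measurable]
    define \<kappa> where "\<kappa> = (\<lambda>x. \<mu> x / (2 * l x))"
    have "diagonalized_system h c K k M \<zeta> p q (Q q) (Q p) (Q' q q') (Q' p p') l \<kappa>"
    proof
      show "8 * (h * M * k * (1 + K)) \<le> c"
      proof -
        have "h * (8 * (M * k * (1 + K)) + 1) \<le> c"
          using h D by (simp add: h0_def pos_less_divide_eq less_imp_le)
        then show ?thesis using h by (simp add: algebra_simps)
      qed
      show "continuous_on UNIV l" by (rule AC_loc_continuous[OF l_AC])
      show "AE x in lebesgue. (Q q has_vector_derivative Q' q q' x) (at x)"
        using p_der q_der by eventually_elim (rule Q_der)
      show "AE x in lebesgue. (Q p has_vector_derivative Q' p p' x) (at x)"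
        using p_der q_der by eventually_elim (rule Q_der)
      show "Q' q q' \<in> borel_measurable lebesgue" "Q' p p' \<in> borel_measurable lebesgue"
        unfolding Q'_def l'_def by measurable
      fix x
      show "norm (\<kappa> x) \<le> k"
      proof -
        have "p x * q x / (2 * l x * \<mu> x) = (l x - \<zeta>) / (2 * l x)"
          using \<mu>0[of x] by (simp add: prod)
        then have "\<kappa> x = 1 - p x * q x / (2 * l x * \<mu> x)"
          using l0[of x] by (simp add: \<kappa>_def \<mu>_def field_simps)
        then have "norm (\<kappa> x) \<le> 1 + norm (p x) * norm (q x) / (2 * norm (l x) * norm (\<mu> x))"
          using norm_triangle_ineq4[of 1 "p x * q x / (2 * l x * \<mu> x)"] by (simp add: norm_mult norm_divide)
        also have "\<dots> \<le> 1 + K0 * K0 / (2 * c * \<delta>)"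
          using p_le[of x] q_le[of x] l_norm[of x] \<mu>_norm[of x] c \<delta> K0
          by (intro add_left_mono frac_le mult_mono) auto
        finally show ?thesis by (simp add: k_def)
      qed
      show "Q q x * p x = l x - \<zeta>" "Q p x * q x = l x - \<zeta>"
        using prod[of x] \<mu>0[of x] by (simp_all add: Q_def field_simps)
      show "q x - \<zeta> * Q q x = l x * Q q x" "p x - \<zeta> * Q p x = l x * Q p x"
        using \<mu>0[of x] by (simp_all add: Q_def \<mu>_def field_simps)
      show "\<kappa> x * (1 + Q q x * Q p x) = 1"
      proof -
        have "Q q x * Q p x = (l x - \<zeta>) / \<mu> x"
          using prod[of x] \<mu>0[of x] by (simp add: Q_def field_simps)
        then have "1 + Q q x * Q p x = 2 * l x / \<mu> x"
          using \<mu>0[of x] by (simp add: field_simps) (simp add: \<mu>_def)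
        then show ?thesis using \<mu>0[of x] l0[of x] by (simp add: \<kappa>_def)
      qed
    qed (use h c nn p q Q_AC Q_le Q'_le p_le q_le p'_le q'_le l_ge in auto)
    then show ?thesis by (rule diagonalized_system.well_posed)
  qed
  moreover have "0 < h0" using c D by (simp add: h0_def)
  ultimately show ?thesis by blast
qed


section \<open>The Dirac operator\<close>

lemma norm_vec2: "(norm (v :: complex^2))\<^sup>2 = (norm (v $ 1))\<^sup>2 + (norm (v $ 2))\<^sup>2"
  by (simp add: norm_vec_def L2_set_def sum_2)

lemma dirac_component:
  "(dirac h p q \<Psi> x - z *s \<Psi> x) $ 1 = \<i> * h * (vector_derivative \<Psi> (at x) $ 1) - \<i> * q x * \<Psi> x $ 2 - z * \<Psi> x $ 1"
  "(dirac h p q \<Psi> x - z *s \<Psi> x) $ 2 = - \<i> * h * (vector_derivative \<Psi> (at x) $ 2) + \<i> * p x * \<Psi> x $ 1 - z * \<Psi> x $ 2"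
  by (simp_all add: dirac_def \<sigma>\<^sub>3_def Q_matrix_def matrix_vector_mult_def sum_2 vector_2 vec_eq_iff)

lemma has_vector_derivative_vec2:
  fixes \<Psi> :: "real \<Rightarrow> complex^2"
  shows "(\<Psi> has_vector_derivative d) (at x) \<longleftrightarrow>
     ((\<lambda>x. \<Psi> x $ 1) has_vector_derivative d $ 1) (at x) \<and> ((\<lambda>x. \<Psi> x $ 2) has_vector_derivative d $ 2) (at x)"
proof
  assume "(\<Psi> has_vector_derivative d) (at x)"
  then show "((\<lambda>x. \<Psi> x $ 1) has_vector_derivative d $ 1) (at x) \<and> ((\<lambda>x. \<Psi> x $ 2) has_vector_derivative d $ 2) (at x)"
    by (intro conjI bounded_linear.has_vector_derivative[OF bounded_linear_vec_nth])
next
  assume *: "((\<lambda>x. \<Psi> x $ 1) has_vector_derivative d $ 1) (at x) \<and> ((\<lambda>x. \<Psi> x $ 2) has_vector_derivative d $ 2) (at x)"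
  have e: "bounded_linear (\<lambda>c. axis i c :: complex^2)" for i
    by (intro linear_conv_bounded_linear[THEN iffD1] linearI) (auto simp: vec_eq_iff axis_def)
  have v: "v = axis 1 (v $ 1) + axis 2 (v $ 2)" for v :: "complex^2"
    by (simp add: vec_eq_iff axis_def forall_2)
  have "((\<lambda>x. axis 1 (\<Psi> x $ 1) + axis 2 (\<Psi> x $ 2) :: complex^2) has_vector_derivative
      axis 1 (d $ 1) + axis 2 (d $ 2)) (at x)"
    using * by (intro has_vector_derivative_add bounded_linear.has_vector_derivative[OF e]) auto
  then show "(\<Psi> has_vector_derivative d) (at x)" by (simp flip: v)
qed

text \<open>
  The two components of \<open>(\<DD> - z) \<Psi> = f\<close> are multiplied by \<open>-i\<close> and \<open>i\<close> to obtain \<open>h \<Psi>'\<close>; this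
  makes \<open>\<zeta> = i z\<close> and leaves the moduli of the components of \<open>f\<close> unchanged.
\<close>

lemma dirac_iff_first_order_solution:
  fixes \<Psi> f :: "real \<Rightarrow> complex^2"
  assumes h: "0 < h"
  shows "(\<forall>j. (\<lambda>x. \<Psi> x $ j) \<in> AC_loc) \<and> (AE x in lebesgue. \<Psi> differentiable (at x)) \<and>
       (AE x in lebesgue. dirac h p q \<Psi> x - z *s \<Psi> x = f x) \<longleftrightarrow>
     first_order_solution h (\<i> * z) p q (\<lambda>x. - \<i> * f x $ 1) (\<lambda>x. \<i> * f x $ 2) (\<lambda>x. \<Psi> x $ 1) (\<lambda>x. \<Psi> x $ 2)"
proof -
  have h0: "complex_of_real h \<noteq> 0" using h by simp
  have e1: "\<i> * h * d - \<i> * q x * b - z * a = f \<longleftrightarrow> d = (- (\<i> * z) * a + q x * b + - \<i> * f) / h" for d a b f :: complex and x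
  proof -
    have "\<i> * h * d - \<i> * q x * b - z * a = f \<longleftrightarrow> - \<i> * (\<i> * h * d - \<i> * q x * b - z * a) = - \<i> * f" by simp
    also have "\<dots> \<longleftrightarrow> h * d - q x * b + \<i> * z * a = - \<i> * f" by (simp add: algebra_simps)
    also have "\<dots> \<longleftrightarrow> d * h = - (\<i> * z) * a + q x * b + - \<i> * f" by (auto simp: algebra_simps)
    finally show ?thesis using h0 by (simp only: eq_divide_eq) simp
  qed
  have e2: "- \<i> * h * d + \<i> * p x * a - z * b = f \<longleftrightarrow> d = (p x * a + \<i> * z * b + \<i> * f) / h" for d a b f :: complex and x
  proof -
    have "- \<i> * h * d + \<i> * p x * a - z * b = f \<longleftrightarrow> \<i> * (- \<i> * h * d + \<i> * p x * a - z * b) = \<i> * f" by simp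
    also have "\<dots> \<longleftrightarrow> h * d - p x * a - \<i> * z * b = \<i> * f" by (simp add: algebra_simps)
    also have "\<dots> \<longleftrightarrow> d * h = p x * a + \<i> * z * b + \<i> * f" by (auto simp: algebra_simps)
    finally show ?thesis using h0 by (simp only: eq_divide_eq) simp
  qed
  have pointwise: "\<Psi> differentiable (at x) \<and> dirac h p q \<Psi> x - z *s \<Psi> x = f x \<longleftrightarrow>
     ((\<lambda>x. \<Psi> x $ 1) has_vector_derivative (- (\<i> * z) * \<Psi> x $ 1 + q x * \<Psi> x $ 2 + - \<i> * f x $ 1) / h) (at x) \<and>
     ((\<lambda>x. \<Psi> x $ 2) has_vector_derivative (p x * \<Psi> x $ 1 + \<i> * z * \<Psi> x $ 2 + \<i> * f x $ 2) / h) (at x)" (is "?L \<longleftrightarrow> ?R") for x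
  proof -
    have eq: "dirac h p q \<Psi> x - z *s \<Psi> x = f x \<longleftrightarrow>
       vector_derivative \<Psi> (at x) $ 1 = (- (\<i> * z) * \<Psi> x $ 1 + q x * \<Psi> x $ 2 + - \<i> * f x $ 1) / h \<and>
       vector_derivative \<Psi> (at x) $ 2 = (p x * \<Psi> x $ 1 + \<i> * z * \<Psi> x $ 2 + \<i> * f x $ 2) / h"
      unfolding vec_eq_iff[of _ "f x"] forall_2 dirac_component e1 e2 ..
    show ?thesis
    proof
      assume ?L
      then have "(\<Psi> has_vector_derivative vector_derivative \<Psi> (at x)) (at x)"
        by (simp add: vector_derivative_works)
      with \<open>?L\<close> show ?R unfolding has_vector_derivative_vec2 eq by auto
    next
      assume R: ?R
      define d :: "complex^2" where "d = vector [(- (\<i> * z) * \<Psi> x $ 1 + q x * \<Psi> x $ 2 + - \<i> * f x $ 1) / h,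
        (p x * \<Psi> x $ 1 + \<i> * z * \<Psi> x $ 2 + \<i> * f x $ 2) / h]"
      have "(\<Psi> has_vector_derivative d) (at x)"
        using R unfolding has_vector_derivative_vec2 d_def vector_2 .
      moreover from this have "vector_derivative \<Psi> (at x) = d" by (rule vector_derivative_at)
      ultimately show ?L unfolding eq by (auto simp: d_def intro: differentiableI_vector)
    qed
  qed
  have "(AE x in lebesgue. \<Psi> differentiable (at x)) \<and> (AE x in lebesgue. dirac h p q \<Psi> x - z *s \<Psi> x = f x)
     \<longleftrightarrow> (AE x in lebesgue. \<Psi> differentiable (at x) \<and> dirac h p q \<Psi> x - z *s \<Psi> x = f x)"
    by (rule AE_conj_iff[symmetric])
  then show ?thesis
    unfolding first_order_solution_def pointwise forall_2 by blast
qed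

lemma measurable_vec2:
  fixes \<Psi> :: "real \<Rightarrow> complex^2"
  assumes "\<Psi> \<in> borel_measurable lebesgue" shows "(\<lambda>x. \<Psi> x $ j) \<in> borel_measurable lebesgue"
proof -
  have "(\<lambda>v :: complex^2. v $ j) \<in> borel_measurable borel"
    by (intro borel_measurable_continuous_onI continuous_intros)
  from measurable_compose[OF assms this] show ?thesis .
qed

lemma L2_iff: "\<Psi> \<in> L2 \<longleftrightarrow> \<Psi> \<in> borel_measurable lebesgue \<and> square_integrable (\<lambda>x. \<Psi> x $ 1) (\<lambda>x. \<Psi> x $ 2)"
  by (simp add: L2_def square_integrable_def norm_vec2)

lemma L2_norm_eq: "L2_norm \<Psi> = sqrt (square_integral (\<lambda>x. \<Psi> x $ 1) (\<lambda>x. \<Psi> x $ 2))"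
  by (simp add: L2_norm_def square_integral_def norm_vec2)

lemma L2_add_smult:
  assumes f: "f \<in> L2" and g: "g \<in> L2" shows "(\<lambda>x. f x + z *s g x) \<in> L2"
  unfolding L2_def
proof (intro CollectI conjI)
  have [measurable]: "f \<in> borel_measurable lebesgue" "g \<in> borel_measurable lebesgue"
    using f g by (auto simp: L2_def)
  have "continuous_on UNIV (\<lambda>v :: complex^2. z *s v)"
    unfolding vector_scalar_mult_def by (intro continuous_intros)
  then have [measurable]: "(\<lambda>v :: complex^2. z *s v) \<in> borel_measurable borel"
    by (rule borel_measurable_continuous_onI)
  show [measurable]: "(\<lambda>x. f x + z *s g x) \<in> borel_measurable lebesgue" by measurable
  show "integrable lebesgue (\<lambda>x. (norm (f x + z *s g x))\<^sup>2)"
  proof (rule Bochner_Integration.integrable_bound)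
    show "integrable lebesgue (\<lambda>x. 2 * (norm (f x))\<^sup>2 + 2 * (norm z)\<^sup>2 * (norm (g x))\<^sup>2)"
      using f g by (simp add: L2_def)
    have "(norm (f x + z *s g x))\<^sup>2 \<le> 2 * (norm (f x))\<^sup>2 + 2 * (norm z)\<^sup>2 * (norm (g x))\<^sup>2" for x
      using norm_sq_combination[of z "norm z" "f x $ 1" "g x $ 1"] norm_sq_combination[of z "norm z" "f x $ 2" "g x $ 2"]
      by (simp add: norm_vec2 algebra_simps)
    then show "AE x in lebesgue. norm ((norm (f x + z *s g x))\<^sup>2)
        \<le> norm (2 * (norm (f x))\<^sup>2 + 2 * (norm z)\<^sup>2 * (norm (g x))\<^sup>2)" by simp
  qed measurable
qed

lemma L2_cong_AE:
  assumes f: "f \<in> L2" and fg: "AE x in lebesgue. f x = g x" shows "g \<in> L2"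
proof -
  have m: "f \<in> borel_measurable lebesgue" "g \<in> borel_measurable lebesgue"
    using f borel_measurable_AE[OF _ fg] by (auto simp: L2_def)
  have "integrable lebesgue (\<lambda>x. (norm (f x))\<^sup>2) \<longleftrightarrow> integrable lebesgue (\<lambda>x. (norm (g x))\<^sup>2)"
  proof (rule integrable_cong_AE)
    show "AE x in lebesgue. (norm (f x))\<^sup>2 = (norm (g x))\<^sup>2"
      using fg by eventually_elim simp
  qed (use m in measurable)
  then show ?thesis using f m by (simp add: L2_def)
qed

lemma first_order_solution_diff:
  assumes "first_order_solution h \<zeta> p q g1 g2 v1 v2" "first_order_solution h \<zeta> p q g1 g2 w1 w2"
  shows "first_order_solution h \<zeta> p q (\<lambda>_. 0) (\<lambda>_. 0) (\<lambda>x. v1 x - w1 x) (\<lambda>x. v2 x - w2 x)"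
proof -
  have "AE x in lebesgue.
      ((\<lambda>x. v1 x - w1 x) has_vector_derivative (- \<zeta> * (v1 x - w1 x) + q x * (v2 x - w2 x) + 0) / complex_of_real h) (at x) \<and>
      ((\<lambda>x. v2 x - w2 x) has_vector_derivative (p x * (v1 x - w1 x) + \<zeta> * (v2 x - w2 x) + 0) / complex_of_real h) (at x)"
    using assms[unfolded first_order_solution_def, THEN conjunct2, THEN conjunct2]
  proof eventually_elim
    case (elim x)
    have lin: "(- \<zeta> * (v1 x - w1 x) + q x * (v2 x - w2 x) + 0) / complex_of_real h
        = (- \<zeta> * v1 x + q x * v2 x + g1 x) / h - (- \<zeta> * w1 x + q x * w2 x + g1 x) / h"
      "(p x * (v1 x - w1 x) + \<zeta> * (v2 x - w2 x) + 0) / complex_of_real h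
        = (p x * v1 x + \<zeta> * v2 x + g2 x) / h - (p x * w1 x + \<zeta> * w2 x + g2 x) / h"
      by (simp_all add: algebra_simps flip: diff_divide_distrib add_divide_distrib)
    show ?case unfolding lin using elim by (intro conjI has_vector_derivative_diff) auto
  qed
  then show ?thesis using assms AC_loc_diff by (auto simp: first_order_solution_def)
qed

lemma resolvent_set_if_well_posed:
  assumes h: "0 < h" and wp: "well_posed h (\<i> * z) p q"
  shows "z \<in> resolvent_set (dirac_domain h p q) (dirac h p q)"
proof -
  let ?D = "dirac_domain h p q" and ?T = "dirac h p q"
  obtain C where C: "\<And>g1 g2 v1 v2. first_order_solution h (\<i> * z) p q g1 g2 v1 v2 \<Longrightarrow>
       square_integrable g1 g2 \<Longrightarrow> square_integrable v1 v2 \<Longrightarrow> square_integral v1 v2 \<le> C * square_integral g1 g2"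
    using wp unfolding well_posed_def by blast
  have solD: "first_order_solution h (\<i> * z) p q (\<lambda>x. - \<i> * f x $ 1) (\<lambda>x. \<i> * f x $ 2) (\<lambda>x. \<Psi> x $ 1) (\<lambda>x. \<Psi> x $ 2)"
    if "\<Psi> \<in> ?D" "AE x in lebesgue. ?T \<Psi> x - z *s \<Psi> x = f x" for \<Psi> f
    using that dirac_iff_first_order_solution[OF h, of \<Psi> p q z f] by (auto simp: dirac_domain_def)
  have minus: "(\<lambda>x. f x - z *s g x) = (\<lambda>x. f x + (- z) *s g x)" for f g :: "real \<Rightarrow> complex^2"
    by (simp add: fun_eq_iff)
  have sources: "square_integrable (\<lambda>x. - \<i> * f x $ 1) (\<lambda>x. \<i> * f x $ 2) = square_integrable (\<lambda>x. f x $ 1) (\<lambda>x. f x $ 2)"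
    "square_integral (\<lambda>x. - \<i> * f x $ 1) (\<lambda>x. \<i> * f x $ 2) = square_integral (\<lambda>x. f x $ 1) (\<lambda>x. f x $ 2)"
    for f :: "real \<Rightarrow> complex^2"
    by (simp_all add: square_integrable_def square_integral_def norm_mult)
  have "AE x in lebesgue. \<Psi> x = \<Phi> x"
    if D: "\<Psi> \<in> ?D" "\<Phi> \<in> ?D" and eq: "AE x in lebesgue. ?T \<Psi> x - z *s \<Psi> x = ?T \<Phi> x - z *s \<Phi> x" for \<Psi> \<Phi>
  proof -
    define \<Delta> where "\<Delta> = (\<lambda>x. \<Psi> x + (- 1) *s \<Phi> x)"
    have \<Delta>j: "\<Delta> x $ j = \<Psi> x $ j - \<Phi> x $ j" for x j by (simp add: \<Delta>_def)
    have \<Delta>: "\<Delta> \<in> L2" unfolding \<Delta>_def using D by (intro L2_add_smult) (auto simp: dirac_domain_def)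
    have "first_order_solution h (\<i> * z) p q (\<lambda>_. 0) (\<lambda>_. 0) (\<lambda>x. \<Delta> x $ 1) (\<lambda>x. \<Delta> x $ 2)"
      unfolding \<Delta>j by (rule first_order_solution_diff[OF solD[OF D(1) eq] solD[OF D(2)]]) simp
    from C[OF this] have "square_integral (\<lambda>x. \<Delta> x $ 1) (\<lambda>x. \<Delta> x $ 2) \<le> 0"
      using \<Delta> by (simp add: L2_iff square_integrable_def[of "\<lambda>_. 0"] square_integral_def[of "\<lambda>_. 0"])
    then have "(LINT x|lebesgue. (norm (\<Delta> x))\<^sup>2) \<le> 0"
      by (simp add: square_integral_def norm_vec2)
    then have "(LINT x|lebesgue. (norm (\<Delta> x))\<^sup>2) = 0"
      by (intro antisym Bochner_Integration.integral_nonneg) auto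
    then have "AE x in lebesgue. (norm (\<Delta> x))\<^sup>2 = 0"
      using \<Delta> by (subst (asm) integral_nonneg_eq_0_iff_AE) (auto simp: L2_def)
    then show ?thesis by eventually_elim (simp add: \<Delta>_def vec_eq_iff)
  qed
  moreover have "\<exists>\<Psi>\<in>?D. AE x in lebesgue. ?T \<Psi> x - z *s \<Psi> x = f x" if f: "f \<in> L2" for f
  proof -
    have fm: "(\<lambda>x. f x $ j) \<in> borel_measurable lebesgue" for j
      using f by (intro measurable_vec2) (auto simp: L2_def)
    have "(\<lambda>x. - \<i> * f x $ 1) \<in> borel_measurable lebesgue" "(\<lambda>x. \<i> * f x $ 2) \<in> borel_measurable lebesgue"
      using fm by simp_all
    then obtain v1 v2 where sol: "first_order_solution h (\<i> * z) p q (\<lambda>x. - \<i> * f x $ 1) (\<lambda>x. \<i> * f x $ 2) v1 v2"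
      and v: "square_integrable v1 v2"
      using wp f sources(1)[of f] unfolding well_posed_def L2_iff by blast
    define \<Psi> :: "real \<Rightarrow> complex^2" where "\<Psi> = (\<lambda>x. vector [v1 x, v2 x])"
    have \<Psi>: "(\<lambda>x. \<Psi> x $ 1) = v1" "(\<lambda>x. \<Psi> x $ 2) = v2" by (simp_all add: \<Psi>_def vector_2)
    have props: "\<forall>j. (\<lambda>x. \<Psi> x $ j) \<in> AC_loc" "AE x in lebesgue. \<Psi> differentiable (at x)"
      "AE x in lebesgue. ?T \<Psi> x - z *s \<Psi> x = f x"
      using dirac_iff_first_order_solution[OF h, of \<Psi> p q z f] sol unfolding \<Psi> by auto
    have "continuous_on UNIV (\<lambda>x. \<chi> j. \<Psi> x $ j)"
      using props(1) by (intro continuous_on_vec_lambda AC_loc_continuous) auto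
    then have "\<Psi> \<in> borel_measurable lebesgue" by (intro continuous_lebesgue_measurable) simp
    then have \<Psi>L2: "\<Psi> \<in> L2" using v by (simp add: L2_iff \<Psi>)
    have "(\<lambda>x. f x + z *s \<Psi> x) \<in> L2" by (rule L2_add_smult[OF f \<Psi>L2])
    moreover have "AE x in lebesgue. f x + z *s \<Psi> x = ?T \<Psi> x"
      using props(3) by eventually_elim (metis diff_add_cancel)
    ultimately have "?T \<Psi> \<in> L2" by (rule L2_cong_AE)
    then have "\<Psi> \<in> ?D" using props \<Psi>L2 by (simp add: dirac_domain_def)
    then show ?thesis using props(3) by blast
  qed
  moreover have "L2_norm \<Psi> \<le> sqrt C * L2_norm (\<lambda>x. ?T \<Psi> x - z *s \<Psi> x)" if D: "\<Psi> \<in> ?D" for \<Psi>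
  proof -
    have f: "(\<lambda>x. ?T \<Psi> x - z *s \<Psi> x) \<in> L2"
      unfolding minus using D by (intro L2_add_smult) (auto simp: dirac_domain_def)
    have "square_integral (\<lambda>x. \<Psi> x $ 1) (\<lambda>x. \<Psi> x $ 2)
      \<le> C * square_integral (\<lambda>x. (?T \<Psi> x - z *s \<Psi> x) $ 1) (\<lambda>x. (?T \<Psi> x - z *s \<Psi> x) $ 2)"
      using C[OF solD[OF D, of "\<lambda>x. ?T \<Psi> x - z *s \<Psi> x"]] f D unfolding sources
      by (simp add: L2_iff dirac_domain_def)
    then show ?thesis unfolding L2_norm_eq real_sqrt_mult[symmetric] by simp
  qed
  ultimately show ?thesis unfolding resolvent_set_def by blast
qed

text \<open>
  The point of the segment that is compared with \<open>z\<close> is the one with imaginary part closest to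
  \<open>Im z\<close>.
\<close>

lemma far_from_Sigma_set:
  assumes z: "z \<notin> neighborhood \<delta> (Sigma_set p q)" and m: "m = Linf_norm p * Linf_norm q" "0 \<le> m"
  shows "\<delta> \<le> \<bar>Im z\<bar>" "\<delta> / 2 \<le> \<bar>Re z\<bar> \<or> sqrt m + \<delta> / 2 \<le> \<bar>Im z\<bar>"
proof -
  have far: "\<delta> \<le> dist w z" if "w \<in> Sigma_set p q" for w
    using z that by (force simp: neighborhood_def)
  have "\<delta> \<le> dist (complex_of_real (Re z)) z" by (intro far) (simp add: Sigma_set_def)
  also have "\<dots> = \<bar>Im z\<bar>" by (simp add: dist_norm cmod_def)
  finally show "\<delta> \<le> \<bar>Im z\<bar>" .
  define t where "t = max (- sqrt m) (min (sqrt m) (Im z))"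
  have "t \<in> {- sqrt m..sqrt m}" using m(2) by (auto simp: t_def)
  then have "\<i> * complex_of_real t \<in> Sigma_set p q" by (auto simp: Sigma_set_def m(1)[symmetric])
  from far[OF this] have "\<delta> \<le> norm (\<i> * complex_of_real t - z)" by (simp add: dist_norm)
  also have "\<dots> \<le> \<bar>Re z\<bar> + \<bar>t - Im z\<bar>" using cmod_le[of "\<i> * complex_of_real t - z"] by simp
  finally show "\<delta> / 2 \<le> \<bar>Re z\<bar> \<or> sqrt m + \<delta> / 2 \<le> \<bar>Im z\<bar>"
    using m(2) by (auto simp: t_def max_def min_def split: if_splits)
qed

lemma periodic_continuous_bounded:
  fixes f :: "real \<Rightarrow> complex"
  assumes per: "\<And>x. f (x + 1) = f x" and f: "continuous_on UNIV f"
  obtains K where "\<And>x. norm (f x) \<le> K"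
proof -
  have n: "f (x + of_nat n) = f x" for x n
    by (induction n) (simp_all add: per add.assoc[symmetric] add.commute[of 1])
  have i: "f (x + of_int i) = f x" for x i
  proof (cases i)
    case (nonneg n) then show ?thesis using n[of x n] by simp
  next
    case (neg n) then show ?thesis using n[of "x + of_int i" "Suc n"] by simp
  qed
  have "compact (f ` {0..1})" by (intro compact_continuous_image continuous_on_subset[OF f]) auto
  then obtain K where K: "\<And>x. x \<in> {0..1} \<Longrightarrow> norm (f x) \<le> K"
    by (metis bounded_iff compact_imp_bounded imageI)
  have "norm (f x) \<le> K" for x
  proof -
    have "f x = f (frac x)" using i[of "frac x" "\<lfloor>x\<rfloor>"] by (simp add: frac_def)
    moreover have "frac x \<in> {0..1}" using frac_lt_1[of x] by (simp add: less_imp_le)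
    ultimately show ?thesis using K by simp
  qed
  then show thesis by (rule that)
qed

text \<open>
  A continuous function is bounded by its essential supremum everywhere: the set where it exceeds
  that value is open and null, hence empty. Boundedness of \<open>f\<close> makes the supremum finite, so that its
  conversion to a real number is faithful.
\<close>

lemma norm_le_Linf_norm:
  assumes f: "continuous_on UNIV f" and K: "\<And>x. norm (f x) \<le> K"
  shows "norm (f x) \<le> Linf_norm f"
proof -
  have meas [measurable]: "(\<lambda>x. ereal (norm (f x))) \<in> borel_measurable lebesgue"
    using continuous_lebesgue_measurable[OF f] by simp
  have AE: "AE x in lebesgue. ereal (norm (f x)) \<le> Linf_norm_ereal f"
    unfolding Linf_norm_ereal_def by (rule esssup_AE)
  have le: "Linf_norm_ereal f \<le> ereal K"
    unfolding Linf_norm_ereal_def by (rule esssup_I) (use K in auto)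
  have open_ae: "S = {}" if "open S" "AE x in lebesgue. x \<notin> S" for S :: "real set"
  proof -
    have "S \<in> null_sets lebesgue"
      using that by (subst AE_iff_null_sets) (auto simp: )
    then show ?thesis using open_not_negligible[OF that(1)] by (auto simp: negligible_iff_null_sets)
  qed
  have "Linf_norm_ereal f \<noteq> - \<infinity>"
  proof
    assume "Linf_norm_ereal f = - \<infinity>"
    with AE have "AE x in lebesgue. x \<notin> (UNIV :: real set)" by simp
    then show False using open_ae[OF open_UNIV] by simp
  qed
  then have real: "Linf_norm_ereal f = ereal (Linf_norm f)"
    using le by (cases "Linf_norm_ereal f") (auto simp: Linf_norm_def)
  have "{x. Linf_norm f < norm (f x)} = {}"
  proof (rule open_ae)
    show "open {x. Linf_norm f < norm (f x)}"
      by (intro open_Collect_less continuous_intros f)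
    show "AE x in lebesgue. x \<notin> {x. Linf_norm f < norm (f x)}"
      using AE unfolding real by eventually_elim simp
  qed
  then show ?thesis by (auto simp: not_less)
qed

text \<open>
  Changing the derivative on a null set makes it bounded everywhere, as the pointwise estimates of
  the energy require.
\<close>

lemma bounded_derivative_version:
  assumes f': "f' \<in> Linf" and der: "AE x in lebesgue. (f has_vector_derivative f' x) (at x)"
  obtains B d where "d \<in> borel_measurable lebesgue" "\<forall>x. norm (d x) \<le> B"
    "AE x in lebesgue. (f has_vector_derivative d x) (at x)"
proof -
  have [measurable]: "f' \<in> borel_measurable lebesgue" using f' by (simp add: Linf_def)
  obtain n :: nat where n: "Linf_norm_ereal f' < ereal (real n)"
    using f' less_PInf_Ex_of_nat[of "Linf_norm_ereal f'"] by (auto simp: Linf_def)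
  define d where "d = (\<lambda>x. if norm (f' x) \<le> real n then f' x else 0)"
  have "AE x in lebesgue. ereal (norm (f' x)) \<le> Linf_norm_ereal f'"
    unfolding Linf_norm_ereal_def by (rule esssup_AE)
  then have "AE x in lebesgue. norm (f' x) \<le> real n"
  proof eventually_elim
    case (elim x)
    then have "ereal (norm (f' x)) \<le> ereal (real n)" using n by (meson less_imp_le order_trans)
    then show ?case by simp
  qed
  then have "AE x in lebesgue. (f has_vector_derivative d x) (at x)"
    using der by eventually_elim (simp add: d_def)
  moreover have "d \<in> borel_measurable lebesgue" unfolding d_def by measurable
  moreover have "\<forall>x. norm (d x) \<le> real n" by (simp add: d_def)
  ultimately show thesis by (intro that)
qed

theorem theorem5p3:
  fixes p q p' q' :: "real \<Rightarrow> complex" and \<delta> :: real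
  assumes "\<And>x. p (x + 1) = p x" and "\<And>x. q (x + 1) = q x"
    and "p \<in> AC_loc" and "q \<in> AC_loc"
    and "AE x in lebesgue. (p has_vector_derivative p' x) (at x)" and "p' \<in> Linf"
    and "AE x in lebesgue. (q has_vector_derivative q' x) (at x)" and "q' \<in> Linf"
    and "\<And>x. cnj (p x) * cnj (q x) = p x * q x"
    and "\<delta> > 0"
  shows "\<exists>h\<^sub>o>0. \<forall>h. 0 < h \<and> h < h\<^sub>o \<longrightarrow>
           dirac_spectrum h p q \<subseteq> neighborhood \<delta> (Sigma_set p q)"
proof -
  note cont = AC_loc_continuous[OF \<open>p \<in> AC_loc\<close>, of UNIV] AC_loc_continuous[OF \<open>q \<in> AC_loc\<close>, of UNIV]
  obtain Kp where Kp: "\<And>x. norm (p x) \<le> Kp" using periodic_continuous_bounded[OF assms(1) cont(1)] by blast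
  obtain Kq where Kq: "\<And>x. norm (q x) \<le> Kq" using periodic_continuous_bounded[OF assms(2) cont(2)] by blast
  note p_le = norm_le_Linf_norm[OF cont(1) Kp] and q_le = norm_le_Linf_norm[OF cont(2) Kq]
  obtain Bp dp where dp: "dp \<in> borel_measurable lebesgue" "\<forall>x. norm (dp x) \<le> Bp"
    "AE x in lebesgue. (p has_vector_derivative dp x) (at x)"
    by (rule bounded_derivative_version[OF assms(6,5)])
  obtain Bq dq where dq: "dq \<in> borel_measurable lebesgue" "\<forall>x. norm (dq x) \<le> Bq"
    "AE x in lebesgue. (q has_vector_derivative dq x) (at x)"
    by (rule bounded_derivative_version[OF assms(8,7)])
  define K B m where "K = max Kp Kq" and "B = max Bp Bq" and "m = Linf_norm p * Linf_norm q"
  have bounds: "norm (p x) \<le> K" "norm (q x) \<le> K" "norm (dp x) \<le> B" "norm (dq x) \<le> B" for x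
    using Kp[of x] Kq[of x] dp(2)[rule_format, of x] dq(2)[rule_format, of x] by (auto simp: K_def B_def)
  have pq_le: "norm (p x * q x) \<le> m" for x
    using p_le[of x] q_le[of x] order_trans[OF norm_ge_zero p_le[of x]]
    by (simp add: norm_mult m_def mult_mono)
  then have qp_le: "norm (q x * p x) \<le> m" for x by (simp add: mult.commute)
  have m: "0 \<le> m" using order_trans[OF norm_ge_zero pq_le] .
  have real: "p x * q x \<in> \<real>" "q x * p x \<in> \<real>" for x
    using assms(9)[of x] by (simp_all add: complex_is_Real_iff complex_eq_iff mult.commute)
  obtain h1 where h1: "h1 > 0" "\<And>h \<zeta>. 0 < h \<Longrightarrow> h < h1 \<Longrightarrow> \<delta> \<le> Re \<zeta> \<Longrightarrow>
      \<delta> / 2 \<le> \<bar>Im \<zeta>\<bar> \<or> sqrt m + \<delta> / 2 \<le> Re \<zeta> \<Longrightarrow> well_posed h \<zeta> p q"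
    using exists_semiclassical_threshold[OF assms(3,4) dp(3) dq(3) dp(1) dq(1) bounds(3,4) bounds(1,2) real(1) pq_le assms(10)]
    by blast
  obtain h2 where h2: "h2 > 0" "\<And>h \<zeta>. 0 < h \<Longrightarrow> h < h2 \<Longrightarrow> \<delta> \<le> Re \<zeta> \<Longrightarrow>
      \<delta> / 2 \<le> \<bar>Im \<zeta>\<bar> \<or> sqrt m + \<delta> / 2 \<le> Re \<zeta> \<Longrightarrow> well_posed h \<zeta> q p"
    using exists_semiclassical_threshold[OF assms(4,3) dq(3) dp(3) dq(1) dp(1) bounds(4,3) bounds(2,1) real(2) qp_le assms(10)]
    by blast
  show ?thesis
  proof (intro exI[of _ "min h1 h2"] conjI allI impI subsetI)
    show "min h1 h2 > 0" using h1 h2 by simp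
    fix h z assume h: "0 < h \<and> h < min h1 h2" and z: "z \<in> dirac_spectrum h p q"
    show "z \<in> neighborhood \<delta> (Sigma_set p q)"
    proof (rule ccontr)
      assume "z \<notin> neighborhood \<delta> (Sigma_set p q)"
      note far = far_from_Sigma_set[OF this m_def m]
      have "well_posed h (\<i> * z) p q"
      proof (cases "Im z < 0")
        case True
        then show ?thesis using far h by (intro h1) auto
      next
        case False
        then have "well_posed h (- (\<i> * z)) q p" using far h by (intro h2) auto
        then show ?thesis by (rule well_posed_swap)
      qed
      then have "z \<in> resolvent_set (dirac_domain h p q) (dirac h p q)"
        using h by (intro resolvent_set_if_well_posed) auto
      with z show False by (simp add: dirac_spectrum_def spectrum_def)
    qed
  qed
qed

end
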